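(* Let $G$ be a finite group and let $p$ be a prime divisor of $|G|$. Then the orbit space $|\mathcal S_p(G)|/G$ is contractible.
   Context: $\mathcal S_p(G)$ denotes the set of nontrivial $p$-subgroups of $G$ (subgroups of order $p^k$ with $k\geq 1$), partially ordered by inclusion. $|\mathcal S_p(G)|$ denotes (the geometric realization of) its order complex, i.e., the simplicial complex whose $n$-simplices are the chains $P_0<P_1<\cdots<P_n$ in $\mathcal S_p(G)$. The group $G$ acts on $\mathcal S_p(G)$ by order-preserving maps via conjugation, $P\mapsto gPg^{-1}$, and hence acts on $|\mathcal S_p(G)|$ by simplicial maps. $|\mathcal S_p(G)|/G$ is the quotient topological space of $|\mathcal S_p(G)|$ by this action. *)

theory Defs
  imports "HOL-Analysis.Analysis" "HOL-Algebra.Group_Action"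
begin

definition nontrivial_p_subgroups :: "('a, 'm) monoid_scheme \<Rightarrow> nat \<Rightarrow> 'a set set" where
  "nontrivial_p_subgroups G p = {P. subgroup P G \<and> (\<exists>k\<ge>1. card P = p ^ k)}"

definition order_complex :: "'a set set \<Rightarrow> 'a set set set" where
  "order_complex S = {\<sigma> \<in> chains S. finite \<sigma> \<and> \<sigma> \<noteq> {}}"

text \<open>
  A point of the realization of an abstract simplicial complex \<open>K\<close> is given by its barycentric
  coordinates, extended by \<open>0\<close> to all of the vertex type. It carries the subspace topology of the
  product topology on \<open>'v \<Rightarrow> real\<close>, which is the usual (coherent) topology when \<open>K\<close> is finite;
  for infinite \<open>K\<close> the two may differ.
\<close>

definition realization_points :: "'v set set \<Rightarrow> ('v \<Rightarrow> real) set" where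
  "realization_points K =
     {x. (\<forall>v. 0 \<le> x v) \<and> {v. x v \<noteq> 0} \<in> K \<and> (\<Sum>v | x v \<noteq> 0. x v) = 1}"

definition geometric_realization :: "'v set set \<Rightarrow> ('v \<Rightarrow> real) topology" where
  "geometric_realization K = top_of_set (realization_points K)"

text \<open>
  The linear extension of a vertex map \<open>f\<close>: the vertex \<open>w\<close> receives the total weight of the
  vertices of the support of \<open>x\<close> that \<open>f\<close> sends to \<open>w\<close>.
\<close>

definition realization_map :: "('v \<Rightarrow> 'w) \<Rightarrow> ('v \<Rightarrow> real) \<Rightarrow> 'w \<Rightarrow> real" where
  "realization_map f x = (\<lambda>w. \<Sum>v | x v \<noteq> 0 \<and> f v = w. x v)"

definition conjugate_subset :: "('a, 'm) monoid_scheme \<Rightarrow> 'a \<Rightarrow> 'a set \<Rightarrow> 'a set" where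
  "conjugate_subset G g P = g <#\<^bsub>G\<^esub> P #>\<^bsub>G\<^esub> (inv\<^bsub>G\<^esub> g)"

definition quotient_topology :: "'a topology \<Rightarrow> ('a \<Rightarrow> 'b) \<Rightarrow> 'b topology" where
  "quotient_topology X q =
     topology (\<lambda>U. U \<subseteq> q ` topspace X \<and> openin X {x \<in> topspace X. q x \<in> U})"

lemma openin_quotient_topology:
  "openin (quotient_topology X q) U \<longleftrightarrow>
     U \<subseteq> q ` topspace X \<and> openin X {x \<in> topspace X. q x \<in> U}"
proof -
  have "istopology (\<lambda>U. U \<subseteq> q ` topspace X \<and> openin X {x \<in> topspace X. q x \<in> U})"
    unfolding istopology_def
  proof (intro conjI allI impI)
    fix S T
    assume S: "S \<subseteq> q ` topspace X \<and> openin X {x \<in> topspace X. q x \<in> S}"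
      and T: "T \<subseteq> q ` topspace X \<and> openin X {x \<in> topspace X. q x \<in> T}"
    show "S \<inter> T \<subseteq> q ` topspace X" using S by blast
    have "{x \<in> topspace X. q x \<in> S \<inter> T} =
        {x \<in> topspace X. q x \<in> S} \<inter> {x \<in> topspace X. q x \<in> T}" by blast
    then show "openin X {x \<in> topspace X. q x \<in> S \<inter> T}"
      using S T by (simp only: openin_Int)
  next
    fix \<U>
    assume \<U>: "\<forall>U\<in>\<U>. U \<subseteq> q ` topspace X \<and> openin X {x \<in> topspace X. q x \<in> U}"
    then show "\<Union>\<U> \<subseteq> q ` topspace X" by blast
    have "{x \<in> topspace X. q x \<in> \<Union>\<U>} = (\<Union>U\<in>\<U>. {x \<in> topspace X. q x \<in> U})" by blast
    then show "openin X {x \<in> topspace X. q x \<in> \<Union>\<U>}" using \<U> by auto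
  qed
  then show ?thesis
    by (simp add: quotient_topology_def topology_inverse')
qed

lemma topspace_quotient_topology: "topspace (quotient_topology X q) = q ` topspace X"
proof (rule antisym)
  show "topspace (quotient_topology X q) \<subseteq> q ` topspace X"
    using openin_topspace openin_quotient_topology by metis
  have "{x \<in> topspace X. q x \<in> q ` topspace X} = topspace X" by blast
  then have "openin (quotient_topology X q) (q ` topspace X)"
    by (simp add: openin_quotient_topology)
  then show "q ` topspace X \<subseteq> topspace (quotient_topology X q)"
    by (rule openin_subset)
qed

lemma quotient_map_quotient_topology: "quotient_map X (quotient_topology X q) q"
  by (auto simp: quotient_map_def topspace_quotient_topology openin_quotient_topology)

definition orbit_space ::
    "('g, 'm) monoid_scheme \<Rightarrow> 'x topology \<Rightarrow> ('g \<Rightarrow> 'x \<Rightarrow> 'x) \<Rightarrow> 'x set topology" where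
  "orbit_space G X \<phi> = quotient_topology X (orbit G \<phi>)"

definition p_subgroup_complex_space ::
    "('a, 'm) monoid_scheme \<Rightarrow> nat \<Rightarrow> ('a set \<Rightarrow> real) topology" where
  "p_subgroup_complex_space G p =
     geometric_realization (order_complex (nontrivial_p_subgroups G p))"

definition p_subgroup_orbit_space ::
    "('a, 'm) monoid_scheme \<Rightarrow> nat \<Rightarrow> ('a set \<Rightarrow> real) set topology" where
  "p_subgroup_orbit_space G p =
     orbit_space G (p_subgroup_complex_space G p) (\<lambda>g. realization_map (conjugate_subset G g))"

end

theory Submission
  imports Defs "HOL-Algebra.Sylow" "HOL-Algebra.Left_Coset" "HOL-Number_Theory.Cong"
begin

text \<open>
  The argument is discrete Morse theory on the orbit space. Conjugation preserves the orders of
  subgroups, so an element that carries a member of a chain to a member of the same chain fixes it.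
  Hence every simplex of the realization embeds into the orbit space, which is therefore built from
  the conjugacy classes of chains as if they were simplices. All of these classes but one vertex, the
  class of the Sylow subgroups, are paired off so that each pair can be collapsed.

  For the pairing, let \<open>P\<^sub>0 < \<dots> < P\<^sub>k\<close> be the longest initial segment of a chain \<open>c\<close> in which every
  member normalizes the smaller ones (\<open>normal_part\<close>, with largest member \<open>normal_top\<close>), and let
  \<open>H\<close> (\<open>ambient\<close>) consist of the elements that normalize all these \<open>P\<^sub>i\<close> and lie in \<open>P\<^sub>k\<^sub>+\<^sub>1\<close>,
  if there is such a member. The \<open>p\<close>-group \<open>P\<^sub>k\<close> is normal in \<open>H\<close>; if it is not a Sylow
  subgroup of \<open>H\<close>, then \<open>c\<close> is paired with \<open>c \<union> {R}\<close>, where \<open>R\<close> is a Sylow subgroup of \<open>H\<close>.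
  The choice of \<open>R\<close> is unique up to conjugation by \<open>H\<close>, and \<open>H\<close> fixes every member of \<open>c\<close>, so
  the class of \<open>c \<union> {R}\<close> is well defined although the chain is not. This is where the passage to the
  orbit space is essential. If \<open>P\<^sub>k\<close> is a Sylow subgroup of \<open>H\<close>, then
  \<open>c\<close> arises in this way from \<open>c - {P\<^sub>k}\<close> unless \<open>c\<close> is a single Sylow subgroup of \<open>G\<close>; this
  uses that normalizers grow in \<open>p\<close>-groups (\<open>saturated_cases\<close>). Exchanging any
  member of \<open>c\<close> for \<open>R\<close> strictly enlarges the top of the normal part (\<open>normal_top_grows\<close>), so the
  pairing has no cycles and the pairs can be removed one after the other
  (\<open>contractible_matched_subcomplex\<close>).

  Removing one pair is a deformation retraction of the orbit space (\<open>orbit_collapse\<close>): inside the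
  simplex \<open>\<sigma> \<union> {r}\<close>, weight is moved from \<open>\<sigma>\<close> to \<open>r\<close> until some vertex of \<open>\<sigma>\<close> has weight zero.
  In general there is no such deformation before passing to orbits, because \<open>\<sigma>\<close> may be a face of several
  conjugates of \<open>\<sigma> \<union> {r}\<close>; the homotopy is therefore defined with values in the orbit space and then
  descends along the quotient map.
\<close>

section \<open>Conjugates and normalizers\<close>

context group
begin

abbreviation conj_set :: "'a \<Rightarrow> 'a set \<Rightarrow> 'a set"
  where "conj_set \<equiv> conjugate_subset G"

lemma conj_set_eq_image: "conj_set g P = (\<lambda>x. g \<otimes> x \<otimes> inv g) ` P"
  by (auto simp: conjugate_subset_def l_coset_def r_coset_def)

lemma conj_set_one: "P \<subseteq> carrier G \<Longrightarrow> conj_set \<one> P = P"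
  unfolding conj_set_eq_image by (subst image_cong[OF refl, of _ _ "\<lambda>x. x"]) auto

lemma conj_set_mult:
  assumes "g \<in> carrier G" "h \<in> carrier G" "P \<subseteq> carrier G"
  shows "conj_set (g \<otimes> h) P = conj_set g (conj_set h P)"
proof -
  have "g \<otimes> h \<otimes> x \<otimes> inv (g \<otimes> h) = g \<otimes> (h \<otimes> x \<otimes> inv h) \<otimes> inv g" if "x \<in> P" for x
    using assms that by (auto simp: subset_iff m_assoc inv_mult_group)
  then show ?thesis
    by (auto simp: conj_set_eq_image image_image)
qed

lemma conj_set_mono: "P \<subseteq> Q \<Longrightarrow> conj_set g P \<subseteq> conj_set g Q"
  by (auto simp: conj_set_eq_image)

lemma conj_set_subset_carrier:
  "\<lbrakk>g \<in> carrier G; P \<subseteq> carrier G\<rbrakk> \<Longrightarrow> conj_set g P \<subseteq> carrier G"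
  by (auto simp: conj_set_eq_image)

lemma conj_set_inv:
  assumes "g \<in> carrier G" "P \<subseteq> carrier G"
  shows "conj_set (inv g) (conj_set g P) = P" "conj_set g (conj_set (inv g) P) = P"
  using assms by (simp_all flip: conj_set_mult add: conj_set_one)

lemma conj_set_subset_iff:
  assumes "g \<in> carrier G" "P \<subseteq> carrier G" "Q \<subseteq> carrier G"
  shows "conj_set g P \<subseteq> conj_set g Q \<longleftrightarrow> P \<subseteq> Q"
  using assms conj_set_mono conj_set_inv(1) by metis

lemma card_conj_set:
  assumes "g \<in> carrier G" "P \<subseteq> carrier G"
  shows "card (conj_set g P) = card P"
  unfolding conj_set_eq_image
proof (rule card_image, rule inj_onI)
  fix x y assume "x \<in> P" "y \<in> P" "g \<otimes> x \<otimes> inv g = g \<otimes> y \<otimes> inv g"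
  then show "x = y" using assms by (simp add: subset_iff)
qed

lemma subgroup_conj_set:
  assumes "g \<in> carrier G" "subgroup P G"
  shows "subgroup (conj_set g P) G"
  using subgroup_conjugation_is_surj2[OF assms] by (simp add: conjugate_subset_def)

lemma conj_set_self:
  assumes "subgroup P G" "g \<in> P"
  shows "conj_set g P = P"
proof -
  interpret P: subgroup P G by fact
  have 1: "conj_set h P \<subseteq> P" if "h \<in> P" for h
    using that by (auto simp: conj_set_eq_image)
  have "P = conj_set g (conj_set (inv g) P)"
    using assms P.subset by (simp add: conj_set_inv)
  also have "\<dots> \<subseteq> conj_set g P"
    using 1[of "inv g"] assms by (intro conj_set_mono) auto
  finally show ?thesis using 1[OF assms(2)] by blast
qed

text \<open>
  A family of subgroups rather than a single one, so that the stabilizer of a chain is an instance;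
  the empty family gives the whole group.
\<close>

definition common_normalizer :: "'a set set \<Rightarrow> 'a set"
  where "common_normalizer \<A> = {g \<in> carrier G. \<forall>P\<in>\<A>. conj_set g P = P}"

lemma subgroup_common_normalizer:
  assumes "\<And>P. P \<in> \<A> \<Longrightarrow> P \<subseteq> carrier G"
  shows "subgroup (common_normalizer \<A>) G"
proof (rule subgroupI)
  show "inv g \<in> common_normalizer \<A>" if "g \<in> common_normalizer \<A>" for g
  proof -
    have "conj_set (inv g) P = P" if "P \<in> \<A>" for P
      using conj_set_inv(1)[of g P] assms[OF that] \<open>g \<in> common_normalizer \<A>\<close> that
      by (simp add: common_normalizer_def)
    then show ?thesis using that by (simp add: common_normalizer_def)
  qed
  have "\<one> \<in> common_normalizer \<A>"
    using assms by (auto simp: common_normalizer_def conj_set_one)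
  then show "common_normalizer \<A> \<noteq> {}" by blast
  show "g \<otimes> h \<in> common_normalizer \<A>"
    if "g \<in> common_normalizer \<A>" "h \<in> common_normalizer \<A>" for g h
    using that assms by (simp add: common_normalizer_def conj_set_mult)
qed (simp add: common_normalizer_def)

lemma common_normalizer_Un:
  "common_normalizer (\<A> \<union> \<B>) = common_normalizer \<A> \<inter> common_normalizer \<B>"
  by (auto simp: common_normalizer_def)

lemma subgroup_subset_normalizer:
  assumes "subgroup P G" shows "P \<subseteq> common_normalizer {P}"
  using conj_set_self[OF assms] subgroup.subset[OF assms] by (auto simp: common_normalizer_def)

lemma mem_common_normalizer_iff:
  "x \<in> common_normalizer \<A> \<longleftrightarrow> x \<in> carrier G \<and> (\<forall>P\<in>\<A>. x \<in> common_normalizer {P})"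
  by (auto simp: common_normalizer_def)

lemma mem_conj_set_iff:
  assumes "g \<in> carrier G" "x \<in> carrier G" "B \<subseteq> carrier G"
  shows "x \<in> conj_set g B \<longleftrightarrow> inv g \<otimes> x \<otimes> g \<in> B"
proof
  assume "x \<in> conj_set g B"
  then obtain b where "b \<in> B" "x = g \<otimes> b \<otimes> inv g" by (auto simp: conj_set_eq_image)
  moreover have "inv g \<otimes> (g \<otimes> b \<otimes> inv g) \<otimes> g = b" if "b \<in> carrier G" for b
    using assms(1) that by (simp add: m_assoc) (simp add: inv_solve_left m_assoc[symmetric])
  ultimately show "inv g \<otimes> x \<otimes> g \<in> B" using assms(3) by auto
next
  assume "inv g \<otimes> x \<otimes> g \<in> B"
  moreover have "x = g \<otimes> (inv g \<otimes> x \<otimes> g) \<otimes> inv g"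
    using assms(1,2) by (simp add: m_assoc) (simp add: m_assoc[symmetric])
  ultimately show "x \<in> conj_set g B" unfolding conj_set_eq_image by blast
qed

text \<open>
  Conjugating by \<open>k\<close> maps the one side into the other; applied to the inverse of \<open>k\<close>, this yields
  the reverse inclusion.
\<close>

lemma conj_set_common_normalizer:
  assumes k: "k \<in> carrier G" and A: "\<And>P. P \<in> \<A> \<Longrightarrow> P \<subseteq> carrier G"
  shows "conj_set k (common_normalizer \<A>) = common_normalizer (conj_set k ` \<A>)"
proof -
  have sub: "conj_set k (common_normalizer \<A>) \<subseteq> common_normalizer (conj_set k ` \<A>)"
    if k: "k \<in> carrier G" and A: "\<And>P. P \<in> \<A> \<Longrightarrow> P \<subseteq> carrier G" for k \<A>
  proof
    fix x assume "x \<in> conj_set k (common_normalizer \<A>)"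
    then obtain g where g: "g \<in> carrier G" "\<forall>P\<in>\<A>. conj_set g P = P" and x: "x = k \<otimes> g \<otimes> inv k"
      by (auto simp: conj_set_eq_image common_normalizer_def)
    have "conj_set x (conj_set k P) = conj_set k P" if "P \<in> \<A>" for P
    proof -
      have "conj_set x (conj_set k P) = conj_set (k \<otimes> g) (conj_set (inv k) (conj_set k P))"
        using k g A[OF that] by (simp add: x conj_set_mult conj_set_subset_carrier)
      then show ?thesis
        using k g A[OF that] that by (simp add: conj_set_inv conj_set_mult)
    qed
    then show "x \<in> common_normalizer (conj_set k ` \<A>)"
      using k g x by (auto simp: common_normalizer_def)
  qed
  show ?thesis
  proof
    have *: "conj_set (inv k) ` conj_set k ` \<A> = \<A>"
      using k A by (simp add: image_image conj_set_inv)
    have "conj_set (inv k) (common_normalizer (conj_set k ` \<A>)) \<subseteq> common_normalizer \<A>"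
      using sub[of "inv k" "conj_set k ` \<A>"] k A conj_set_subset_carrier
      unfolding * by blast
    then have "conj_set k (conj_set (inv k) (common_normalizer (conj_set k ` \<A>)))
        \<subseteq> conj_set k (common_normalizer \<A>)"
      by (rule conj_set_mono)
    then show "common_normalizer (conj_set k ` \<A>) \<subseteq> conj_set k (common_normalizer \<A>)"
      using k by (subst (asm) conj_set_inv(2)) (auto simp: common_normalizer_def)
  qed (use sub k A in blast)
qed

end

section \<open>Fixed points of p-groups and maximal p-subgroups\<close>

text \<open>
  The library's notion of an action asks for permutations that are undefined outside the set acted
  on; this turns the usual pointwise laws into such an action.
\<close>

lemma (in group) group_actionI:
  assumes "\<And>g x. \<lbrakk>g \<in> carrier G; x \<in> E\<rbrakk> \<Longrightarrow> \<psi> g x \<in> E"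
    and "\<And>x. x \<in> E \<Longrightarrow> \<psi> \<one> x = x"
    and mult: "\<And>g h x. \<lbrakk>g \<in> carrier G; h \<in> carrier G; x \<in> E\<rbrakk> \<Longrightarrow> \<psi> (g \<otimes> h) x = \<psi> g (\<psi> h x)"
  shows "group_action G E (\<lambda>g. restrict (\<psi> g) E)"
proof -
  have inv: "\<psi> (inv g) (\<psi> g x) = x" "\<psi> g (\<psi> (inv g) x) = x" if "g \<in> carrier G" "x \<in> E" for g x
    using that assms(2) by (simp_all flip: mult)
  have bij: "restrict (\<psi> g) E \<in> Bij E" if g: "g \<in> carrier G" for g
  proof -
    have "bij_betw (\<psi> g) E E"
      by (rule bij_betwI[where g = "\<psi> (inv g)"]) (use g assms inv in auto)
    then show ?thesis
      by (simp add: Bij_def cong: bij_betw_cong)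
  qed
  have "(\<lambda>g. restrict (\<psi> g) E) \<in> hom G (BijGroup E)"
  proof (rule homI)
    show "restrict (\<psi> g) E \<in> carrier (BijGroup E)" if "g \<in> carrier G" for g
      using bij[OF that] by (simp add: BijGroup_def)
    show "restrict (\<psi> (g \<otimes> h)) E = restrict (\<psi> g) E \<otimes>\<^bsub>BijGroup E\<^esub> restrict (\<psi> h) E"
      if "g \<in> carrier G" "h \<in> carrier G" for g h
      using bij[OF that(1)] bij[OF that(2)] that assms
      by (auto simp: BijGroup_def compose_def fun_eq_iff)
  qed
  then show ?thesis
    by (simp add: group_action_def group_hom_def group_hom_axioms_def group_BijGroup)
qed

text \<open>
  The set is a disjoint union of orbits, and the length of an orbit divides \<open>p ^ k\<close>: it is either
  one, for a fixed point, or a multiple of \<open>p\<close>.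
\<close>

lemma (in group_action) card_cong_fixed_points:
  assumes p: "Factorial_Ring.prime p" and G: "order G = p ^ k" and E: "finite E"
  shows "[card E = card {x \<in> E. \<forall>g \<in> carrier G. \<phi> g x = x}] (mod p)"
proof -
  interpret G: group G using group_hom group_hom_def by blast
  define F where "F = {x \<in> E. \<forall>g \<in> carrier G. \<phi> g x = x}"
  have part: "partition E (orbits G E \<phi>)" by (rule orbit_partition)
  have orb: "orbit G \<phi> x \<subseteq> E" if "x \<in> E" for x
    using that element_image by (auto simp: orbit_def)
  have x: "x \<in> orbit G \<phi> x" if "x \<in> E" for x
    by (rule orbit_refl[OF that])
  have fin: "finite (orbits G E \<phi>)"
    using E by (simp add: orbits_def setcompr_eq_image)
  (* the orbits of length one, that is, the fixed points *)
  define O1 where "O1 = {C \<in> orbits G E \<phi>. card C = 1}"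
  have O1: "O1 = (\<lambda>x. {x}) ` F"
  proof
    show "(\<lambda>x. {x}) ` F \<subseteq> O1"
    proof
      fix C assume "C \<in> (\<lambda>x. {x}) ` F"
      then obtain y where y: "y \<in> E" "\<forall>g \<in> carrier G. \<phi> g y = y" "C = {y}" by (auto simp: F_def)
      have "orbit G \<phi> y = (\<lambda>g. \<phi> g y) ` carrier G" unfolding orbit_def by blast
      also have "\<dots> = (\<lambda>g. y) ` carrier G" by (rule image_cong[OF refl]) (simp add: y(2))
      also have "\<dots> = {y}" using G.one_closed by auto
      finally have "C \<in> orbits G E \<phi>" using y unfolding orbits_def by blast
      then show "C \<in> O1" using y by (simp add: O1_def)
    qed
    show "O1 \<subseteq> (\<lambda>x. {x}) ` F"
    proof
      fix C assume "C \<in> O1"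
      then obtain y where y: "y \<in> E" "C = orbit G \<phi> y" "card C = 1"
        by (auto simp: O1_def orbits_def)
      then obtain z where z: "C = {z}" by (meson card_1_singletonE)
      have yz: "z = y" using x[OF y(1)] unfolding y(2)[symmetric] z by simp
      have "\<phi> g y \<in> C" if "g \<in> carrier G" for g
        using that unfolding y(2) orbit_def by blast
      then have "y \<in> F" using y(1) unfolding z yz F_def by simp
      then show "C \<in> (\<lambda>x. {x}) ` F" unfolding z yz by blast
    qed
  qed
  have dvd: "p dvd card C" if C: "C \<in> orbits G E \<phi> - O1" for C
  proof -
    obtain y where y: "y \<in> E" "C = orbit G \<phi> y" using C by (auto simp: orbits_def)
    have "card C dvd p ^ k"
      unfolding y(2) G[symmetric] orbit_stabilizer_theorem[OF y(1), symmetric] by simp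
    then obtain j where j: "card C = p ^ j" using divides_primepow_nat[OF p] by blast
    with C have "j \<noteq> 0" by (auto simp: O1_def intro: ccontr)
    then show ?thesis using j by simp
  qed
  have "\<Union>(orbits G E \<phi>) = E" using x orb unfolding orbits_def by blast
  moreover have "disjoint (orbits G E \<phi>)"
  proof (rule disjointI)
    fix A B assume AB: "A \<in> orbits G E \<phi>" "B \<in> orbits G E \<phi>" "A \<noteq> B"
    show "A \<inter> B = {}"
    proof (rule ccontr)
      assume "A \<inter> B \<noteq> {}"
      then obtain z where z: "z \<in> A" "z \<in> B" by blast
      then have "z \<in> E" using AB orb unfolding orbits_def by blast
      then show False
        using part AB z unfolding partition_def by metis
    qed
  qed
  ultimately have "card E = (\<Sum>C\<in>orbits G E \<phi>. card C)"
    using card_Union_disjoint[of "orbits G E \<phi>"] orb E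
    by (metis Sup_upper infinite_super)
  also have "\<dots> = (\<Sum>C\<in>orbits G E \<phi> - O1. card C) + (\<Sum>C\<in>O1. card C)"
    by (rule sum.subset_diff) (auto simp: O1_def fin)
  also have "(\<Sum>C\<in>O1. card C) = card O1"
    by (simp add: O1_def)
  also have "card O1 = card F"
    unfolding O1 by (rule card_image) (simp add: inj_on_def)
  finally have "card E = (\<Sum>C\<in>orbits G E \<phi> - O1. card C) + card F" .
  moreover have "p dvd (\<Sum>C\<in>orbits G E \<phi> - O1. card C)"
    by (rule dvd_sum) (rule dvd)
  ultimately show ?thesis
    unfolding F_def[symmetric] by (auto simp: cong_def elim!: dvdE)
qed

lemma (in group) card_left_cosets:
  assumes fin: "finite (carrier G)" and H: "subgroup H G" and Q: "subgroup Q G" "Q \<subseteq> H"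
  shows "card ((\<lambda>x. x <# Q) ` H) * card Q = card H"
proof -
  interpret GH: group "G\<lparr>carrier := H\<rparr>" by (rule subgroup_imp_group[OF H])
  have "lcosets\<^bsub>G\<lparr>carrier := H\<rparr>\<^esub> Q = (\<lambda>x. x <# Q) ` H"
    by (auto simp: LCOSETS_def l_coset_def)
  moreover have "finite H" by (rule finite_subset[OF subgroup.subset[OF H] fin])
  ultimately show ?thesis
    using GH.l_lagrange[of Q] subgroup_incl[OF Q(1) H Q(2)] by (simp add: order_def)
qed

text \<open>
  The stabilizer of the coset \<open>x Q\<close> under left multiplication is the conjugate of \<open>Q\<close> by \<open>x\<close>.
\<close>

lemma (in group) fixes_left_coset_iff:
  assumes P: "P \<subseteq> carrier G" and Q: "subgroup Q G" and x: "x \<in> carrier G"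
  shows "(\<forall>g\<in>P. g <# (x <# Q) = x <# Q) \<longleftrightarrow> P \<subseteq> conj_set x Q"
proof
  assume fix_x: "\<forall>g\<in>P. g <# (x <# Q) = x <# Q"
  show "P \<subseteq> conj_set x Q"
  proof
    fix g assume g: "g \<in> P"
    then have gG: "g \<in> carrier G" using P by blast
    have "x \<in> x <# Q" by (rule lcos_self[OF x Q])
    then have "g \<otimes> x \<in> g <# (x <# Q)" unfolding l_coset_def by blast
    then have "g \<otimes> x \<in> x <# Q" using fix_x g by simp
    then obtain q where q: "q \<in> Q" "g \<otimes> x = x \<otimes> q" by (auto simp: l_coset_def)
    have "g = g \<otimes> x \<otimes> inv x" using gG x by (simp add: m_assoc)
    then have "g = x \<otimes> q \<otimes> inv x" using q(2) by simp
    then show "g \<in> conj_set x Q" using q(1) by (auto simp: conj_set_eq_image)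
  qed
next
  assume sub: "P \<subseteq> conj_set x Q"
  show "\<forall>g\<in>P. g <# (x <# Q) = x <# Q"
  proof
    fix g assume g: "g \<in> P"
    then obtain q where q: "q \<in> Q" "g = x \<otimes> q \<otimes> inv x"
      using sub by (auto simp: conj_set_eq_image)
    have QG: "Q \<subseteq> carrier G" by (rule subgroup.subset[OF Q])
    then have qG: "q \<in> carrier G" using q(1) by blast
    have "g <# (x <# Q) = (g \<otimes> x) <# Q"
      using g P x QG by (intro lcos_m_assoc) auto
    also have "g \<otimes> x = x \<otimes> q" using q(2) x qG by (simp add: m_assoc)
    also have "(x \<otimes> q) <# Q = x <# (q <# Q)"
      using x qG QG by (simp add: lcos_m_assoc)
    also have "q <# Q = Q" using coset_join3[OF qG Q q(1)] .
    finally show "g <# (x <# Q) = x <# Q" .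
  qed
qed

locale finite_group_prime = group G for G (structure) +
  fixes p :: nat
  assumes finite_carrier: "finite (carrier G)"
    and prime_p: "Factorial_Ring.prime p"
begin

abbreviation p_subgroups :: "'a set set"
  where "p_subgroups \<equiv> nontrivial_p_subgroups G p"

lemma p_subgroupD:
  assumes "P \<in> p_subgroups"
  shows "subgroup P G" "P \<subseteq> carrier G" "finite P" "1 < card P"
proof -
  show P: "subgroup P G" using assms by (simp add: nontrivial_p_subgroups_def)
  then show "P \<subseteq> carrier G" by (rule subgroup.subset)
  then show "finite P" using finite_carrier by (rule finite_subset)
  obtain k where "k \<ge> 1" "card P = p ^ k" using assms by (auto simp: nontrivial_p_subgroups_def)
  then show "1 < card P" using one_less_power[OF prime_gt_1_nat[OF prime_p], of k] by simp
qed

lemma p_subgroup_conj_set: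
  assumes "P \<in> p_subgroups" "g \<in> carrier G"
  shows "conj_set g P \<in> p_subgroups"
  using assms p_subgroupD(2)[OF assms(1)]
  by (simp add: nontrivial_p_subgroups_def subgroup_conj_set card_conj_set)

lemma card_subgroup_dvd:
  assumes "subgroup H G" "subgroup Q G" "Q \<subseteq> H"
  shows "card Q dvd card H"
  using card_left_cosets[OF finite_carrier assms] by (metis dvd_triv_right)

text \<open>
  A subgroup of a \<open>p\<close>-group has \<open>p\<close>-power order by Lagrange; the lower bound \<open>T\<close> keeps it
  nontrivial.
\<close>

lemma p_subgroup_between:
  assumes T: "T \<in> p_subgroups" and Q: "Q \<in> p_subgroups"
    and R: "subgroup R G" "T \<subseteq> R" "R \<subseteq> Q"
  shows "R \<in> p_subgroups"
proof -
  obtain k where k: "card Q = p ^ k" using Q by (auto simp: nontrivial_p_subgroups_def)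
  have "card R dvd p ^ k"
    using card_subgroup_dvd[OF p_subgroupD(1)[OF Q] R(1) R(3)] k by simp
  then obtain j where j: "card R = p ^ j" using divides_primepow_nat[OF prime_p] by blast
  have "card T \<le> card R"
    by (rule card_mono[OF finite_subset[OF subgroup.subset[OF R(1)] finite_carrier] R(2)])
  then have "j \<noteq> 0" using p_subgroupD(4)[OF T] j by (intro notI) simp
  then show ?thesis
    using R(1) j by (auto simp: nontrivial_p_subgroups_def intro!: exI[of _ j])
qed

text \<open>
  Both facts about \<open>p\<close>-groups used below, growth of normalizers and conjugacy of maximal
  \<open>p\<close>-subgroups, come from counting the cosets of \<open>Q\<close> that \<open>P\<close> fixes by left multiplication.
\<close>

lemma card_cosets_fixed_by_p_subgroup:
  assumes H: "subgroup H G" and Q: "subgroup Q G" "Q \<subseteq> H"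
    and P: "P \<in> p_subgroups" "P \<subseteq> H"
  shows "[card H div card Q = card ((\<lambda>x. x <# Q) ` {x \<in> H. P \<subseteq> conj_set x Q})] (mod p)"
proof -
  have HG: "H \<subseteq> carrier G" and QG: "Q \<subseteq> carrier G" and PG: "P \<subseteq> carrier G"
    using subgroup.subset[OF H] subgroup.subset[OF Q(1)] p_subgroupD(2)[OF P(1)] by auto
  define E where "E = (\<lambda>x. x <# Q) ` H"
  interpret GP: group "G\<lparr>carrier := P\<rparr>"
    by (rule subgroup_imp_group[OF p_subgroupD(1)[OF P(1)]])
  have EG: "C \<subseteq> carrier G" if "C \<in> E" for C
  proof -
    obtain x where "x \<in> H" "C = x <# Q" using \<open>C \<in> E\<close> by (auto simp: E_def)
    then show ?thesis using l_coset_subset_G[OF QG, of x] HG by auto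
  qed
  have "group_action (G\<lparr>carrier := P\<rparr>) E (\<lambda>g. restrict (\<lambda>C. g <# C) E)"
  proof (rule GP.group_actionI)
    fix g C assume g: "g \<in> carrier (G\<lparr>carrier := P\<rparr>)" and "C \<in> E"
    then obtain x where x: "x \<in> H" "C = x <# Q" by (auto simp: E_def)
    have "g <# C = (g \<otimes> x) <# Q"
      using g x HG PG QG by (auto simp: lcos_m_assoc subset_iff)
    moreover have "g \<otimes> x \<in> H" using g x P H by (auto simp: subgroup.m_closed)
    ultimately show "g <# C \<in> E" by (auto simp: E_def)
  next
    fix C assume "C \<in> E"
    then show "\<one>\<^bsub>G\<lparr>carrier := P\<rparr>\<^esub> <# C = C"
      using EG by (simp add: lcos_mult_one)
  next
    fix g h C assume "g \<in> carrier (G\<lparr>carrier := P\<rparr>)" "h \<in> carrier (G\<lparr>carrier := P\<rparr>)" "C \<in> E"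
    then show "(g \<otimes>\<^bsub>G\<lparr>carrier := P\<rparr>\<^esub> h) <# C = g <# (h <# C)"
      using EG PG by (auto simp: lcos_m_assoc subset_iff)
  qed
  then interpret act: group_action "G\<lparr>carrier := P\<rparr>" E "\<lambda>g. restrict (\<lambda>C. g <# C) E" .
  obtain k where "card P = p ^ k" using P(1) by (auto simp: nontrivial_p_subgroups_def)
  moreover have "finite E"
    using HG finite_carrier by (auto simp: E_def intro: finite_subset)
  ultimately have "[card E = card {C \<in> E. \<forall>g\<in>P. restrict (\<lambda>C. g <# C) E C = C}] (mod p)"
    using act.card_cong_fixed_points[OF prime_p, of k] by (simp add: order_def)
  moreover have "{C \<in> E. \<forall>g\<in>P. restrict (\<lambda>C. g <# C) E C = C}
      = (\<lambda>x. x <# Q) ` {x \<in> H. P \<subseteq> conj_set x Q}"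
  proof -
    have *: "(\<forall>g\<in>P. restrict (\<lambda>C. g <# C) E (x <# Q) = x <# Q) \<longleftrightarrow> P \<subseteq> conj_set x Q"
      if "x \<in> H" for x
      using fixes_left_coset_iff[OF PG Q(1), of x] that HG by (auto simp: E_def)
    have "{C \<in> E. \<forall>g\<in>P. restrict (\<lambda>C. g <# C) E C = C}
      = (\<lambda>x. x <# Q) ` {x \<in> H. \<forall>g\<in>P. restrict (\<lambda>C. g <# C) E (x <# Q) = x <# Q}"
      unfolding E_def by blast
    also have "{x \<in> H. \<forall>g\<in>P. restrict (\<lambda>C. g <# C) E (x <# Q) = x <# Q}
      = {x \<in> H. P \<subseteq> conj_set x Q}"
      using * by blast
    finally show ?thesis .
  qed
  moreover have "card E = card H div card Q"
  proof -
    have "card Q > 0"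
      using subgroup.one_closed[OF Q(1)] finite_subset[OF QG finite_carrier]
      by (auto simp: card_gt_0_iff)
    then show ?thesis
      using card_left_cosets[OF finite_carrier H Q, symmetric] unfolding E_def by simp
  qed
  ultimately show ?thesis by simp
qed

text \<open>
  Let \<open>P\<close> act on the cosets of \<open>P\<close> in \<open>Q\<close>. Their number is divisible by \<open>p\<close>, hence so is the number
  of fixed ones; as the coset \<open>P\<close> is fixed, there is another one, and its representatives
  normalize \<open>P\<close>.
\<close>

lemma p_subgroup_normalizer_grows:
  assumes P: "P \<in> p_subgroups" and Q: "Q \<in> p_subgroups" and PQ: "P \<subset> Q"
  shows "\<exists>x\<in>Q - P. conj_set x P = P"
proof (rule ccontr)
  assume no: "\<not> ?thesis"
  have PG: "P \<subseteq> carrier G" "finite P" "subgroup P G" and QG: "Q \<subseteq> carrier G" "subgroup Q G"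
    using p_subgroupD P Q by auto
  have eq: "conj_set x P = P" if "x \<in> Q" "P \<subseteq> conj_set x P" for x
  proof -
    have "card P = card (conj_set x P)" using that(1) QG PG by (subst card_conj_set) auto
    moreover have "finite (conj_set x P)" using PG(2) by (simp add: conj_set_eq_image)
    ultimately show ?thesis using card_subset_eq[OF _ that(2)] by simp
  qed
  have "{x \<in> Q. P \<subseteq> conj_set x P} = P"
    using no eq PQ conj_set_self[OF PG(3)] by blast
  moreover have "(\<lambda>x. x <# P) ` P = {P}"
  proof -
    have "(\<lambda>x. x <# P) ` P = (\<lambda>x. P) ` P"
      using PG by (intro image_cong) (auto simp: coset_join3)
    then show ?thesis using subgroup.one_closed[OF PG(3)] by auto
  qed
  ultimately have "[card Q div card P = 1] (mod p)"
    using card_cosets_fixed_by_p_subgroup[OF QG(2) PG(3) _ P] PQ by simp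
  moreover have "p dvd card Q div card P"
  proof -
    obtain m n where mn: "card P = p ^ m" "card Q = p ^ n"
      using P Q by (auto simp: nontrivial_p_subgroups_def)
    have p1: "1 < p" using prime_gt_1_nat[OF prime_p] .
    have "card P < card Q" using PQ p_subgroupD(3)[OF Q] by (rule psubset_card_mono[rotated])
    then have "m < n" using mn p1 by simp
    then have "card Q div card P = p ^ (n - m)"
      using mn p1 by (simp add: power_diff)
    then show ?thesis using \<open>m < n\<close> by simp
  qed
  ultimately have "p dvd 1" by (metis cong_dvd_iff)
  then show False using prime_gt_1_nat[OF prime_p] by simp
qed

text \<open>
  A Sylow \<open>p\<close>-subgroup of \<open>H\<close>, described by maximality instead of by its order, and required to be
  nontrivial.
\<close>

definition maximal_p_subgroup :: "'a set \<Rightarrow> 'a set \<Rightarrow> bool"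
  where "maximal_p_subgroup H R \<longleftrightarrow>
    R \<in> p_subgroups \<and> R \<subseteq> H \<and> (\<forall>R'\<in>p_subgroups. R \<subseteq> R' \<longrightarrow> R' \<subseteq> H \<longrightarrow> R' = R)"

lemma maximal_p_subgroup_exists:
  assumes "P \<in> p_subgroups" "P \<subseteq> H" "subgroup H G"
  obtains R where "maximal_p_subgroup H R" "P \<subseteq> R"
proof -
  define F where "F = {R \<in> p_subgroups. P \<subseteq> R \<and> R \<subseteq> H}"
  have "F \<subseteq> Pow H" by (auto simp: F_def)
  moreover have "finite H" by (rule finite_subset[OF subgroup.subset[OF assms(3)] finite_carrier])
  ultimately have "finite F" by (auto intro: finite_subset)
  moreover have "P \<in> F" using assms by (auto simp: F_def)
  ultimately obtain R where "R \<in> F" "P \<subseteq> R" "\<forall>R'\<in>F. R \<subseteq> R' \<longrightarrow> R' = R"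
    using finite_has_maximal2[of F P] by metis
  then show thesis
    using that[of R] by (auto simp: F_def maximal_p_subgroup_def)
qed

lemma maximal_p_subgroup_conj_set:
  assumes H: "H \<subseteq> carrier G" and R: "maximal_p_subgroup H R" and g: "g \<in> carrier G"
  shows "maximal_p_subgroup (conj_set g H) (conj_set g R)"
  unfolding maximal_p_subgroup_def
proof (intro conjI ballI impI)
  have R': "R \<in> p_subgroups" "R \<subseteq> H" using R by (auto simp: maximal_p_subgroup_def)
  show "conj_set g R \<in> p_subgroups" using R' g by (simp add: p_subgroup_conj_set)
  show "conj_set g R \<subseteq> conj_set g H" using R' by (simp add: conj_set_mono)
  fix Q assume Q: "Q \<in> p_subgroups" "conj_set g R \<subseteq> Q" "Q \<subseteq> conj_set g H"
  have QG: "Q \<subseteq> carrier G" "R \<subseteq> carrier G" using Q R' p_subgroupD(2) by auto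
  have "conj_set (inv g) Q = R"
    using R Q QG H g p_subgroup_conj_set[OF Q(1), of "inv g"]
      conj_set_mono[OF Q(2), of "inv g"] conj_set_mono[OF Q(3), of "inv g"]
    by (auto simp: maximal_p_subgroup_def conj_set_inv)
  then show "Q = conj_set g R" using conj_set_inv(2)[OF g QG(1)] by simp
qed

text \<open>
  Any \<open>p\<close>-subgroup of \<open>H\<close> acts on the cosets of a Sylow subgroup \<open>S\<close> in \<open>H\<close>. The number of cosets is
  prime to \<open>p\<close>, so one is fixed, which puts the \<open>p\<close>-subgroup into a conjugate of \<open>S\<close>; a maximal one
  is equal to that conjugate.
\<close>

lemma maximal_p_subgroups_conjugate:
  assumes H: "subgroup H G" and P: "maximal_p_subgroup H P" and Q: "maximal_p_subgroup H Q"
  obtains g where "g \<in> H" "conj_set g P = Q"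
proof -
  interpret GH: group "G\<lparr>carrier := H\<rparr>" by (rule subgroup_imp_group[OF H])
  have HG: "H \<subseteq> carrier G" by (rule subgroup.subset[OF H])
  then have finH: "finite H" using finite_carrier by (rule finite_subset)
  have H0: "card H \<noteq> 0" using finH subgroup.one_closed[OF H] by auto
  define a where "a = multiplicity p (card H)"
  obtain m where m: "card H = p ^ a * m" "\<not> p dvd m"
    using H0 prime_p multiplicity_decompose'[of "card H" p] unfolding a_def
    by (metis not_prime_unit)
  obtain S where S: "subgroup S (G\<lparr>carrier := H\<rparr>)" "card S = p ^ a"
    using sylow_thm[OF prime_p GH.group_axioms, of a m] m finH by (auto simp: order_def)
  have SG: "subgroup S G" "S \<subseteq> H"
    using incl_subgroup[OF H S(1)] subgroup.subset[OF S(1)] by auto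
  have conj: "\<exists>x\<in>H. R = conj_set x S" if R: "maximal_p_subgroup H R" for R
  proof -
    have Rp: "R \<in> p_subgroups" "R \<subseteq> H" using R by (auto simp: maximal_p_subgroup_def)
    have "card H div card S = m" using m S prime_gt_0_nat[OF prime_p] by simp
    then have "[m = card ((\<lambda>x. x <# S) ` {x \<in> H. R \<subseteq> conj_set x S})] (mod p)"
      using card_cosets_fixed_by_p_subgroup[OF H SG Rp] by simp
    then have "{x \<in> H. R \<subseteq> conj_set x S} \<noteq> {}"
      using m(2) by (intro notI) (simp add: cong_0_iff)
    then obtain x where x: "x \<in> H" "R \<subseteq> conj_set x S" by blast
    have xG: "x \<in> carrier G" using x HG by blast
    have "conj_set x S \<subseteq> H"
      using x(1) SG(2) H conj_set_mono[OF SG(2), of x] conj_set_self[OF H x(1)] by simp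
    moreover have "conj_set x S \<in> p_subgroups"
    proof -
      have c: "card (conj_set x S) = p ^ a"
        using S(2) card_conj_set[OF xG subgroup.subset[OF SG(1)]] by simp
      have "card R \<le> card (conj_set x S)"
        by (rule card_mono[OF finite_subset[OF \<open>conj_set x S \<subseteq> H\<close> finH] x(2)])
      then have "a \<noteq> 0" using p_subgroupD(4)[OF Rp(1)] c by (intro notI) simp
      then show ?thesis
        using c subgroup_conj_set[OF xG SG(1)]
        by (auto simp: nontrivial_p_subgroups_def intro!: exI[of _ a])
    qed
    ultimately have "conj_set x S = R" using R x(2) by (auto simp: maximal_p_subgroup_def)
    then show ?thesis using x by blast
  qed
  obtain x y where xy: "x \<in> H" "P = conj_set x S" "y \<in> H" "Q = conj_set y S"
    using conj[OF P] conj[OF Q] by blast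
  have SC: "S \<subseteq> carrier G" using SG HG by blast
  have xyG: "x \<in> carrier G" "y \<in> carrier G" using xy HG by auto
  have "conj_set (y \<otimes> inv x) P = conj_set y (conj_set (inv x) (conj_set x S))"
    using xyG SC by (simp add: conj_set_mult conj_set_subset_carrier xy(2))
  also have "\<dots> = Q" using xyG SC by (simp add: conj_set_inv xy(4))
  finally show thesis
    using that[of "y \<otimes> inv x"] xy H by (simp add: subgroup.m_closed subgroup.m_inv_closed)
qed

end

section \<open>Pairing chains of p-subgroups\<close>

lemma finite_chain_Union_mem:
  assumes "finite C" "C \<noteq> {}" "\<And>P Q. \<lbrakk>P \<in> C; Q \<in> C\<rbrakk> \<Longrightarrow> P \<subseteq> Q \<or> Q \<subseteq> P"
  shows "\<Union>C \<in> C"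
proof -
  obtain M where M: "M \<in> C" "\<And>P. \<lbrakk>P \<in> C; M \<subseteq> P\<rbrakk> \<Longrightarrow> M = P"
    using finite_has_maximal[OF assms(1,2)] by blast
  have "P \<subseteq> M" if "P \<in> C" for P using assms(3)[OF that M(1)] M(2)[OF that] by blast
  then have "\<Union>C = M" using M(1) by blast
  then show ?thesis using M(1) by simp
qed

lemma finite_chain_least:
  assumes "finite C" "C \<noteq> {}" "\<And>P Q. \<lbrakk>P \<in> C; Q \<in> C\<rbrakk> \<Longrightarrow> P \<subseteq> Q \<or> Q \<subseteq> P"
  obtains M where "M \<in> C" "\<And>P. P \<in> C \<Longrightarrow> M \<subseteq> P"
proof -
  obtain M where M: "M \<in> C" "\<And>P. \<lbrakk>P \<in> C; P \<subseteq> M\<rbrakk> \<Longrightarrow> M = P"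
    using finite_has_minimal[OF assms(1,2)] by blast
  have "M \<subseteq> P" if "P \<in> C" for P using assms(3)[OF that M(1)] M(2)[OF that] by blast
  then show thesis using that M(1) by blast
qed

lemma order_complexD:
  assumes "c \<in> order_complex S"
  shows "c \<subseteq> S" "finite c" "c \<noteq> {}" "\<And>P Q. \<lbrakk>P \<in> c; Q \<in> c\<rbrakk> \<Longrightarrow> P \<subseteq> Q \<or> Q \<subseteq> P"
  using assms by (auto simp: order_complex_def chains_def chain_subset_def)

lemma order_complexI:
  assumes "c \<subseteq> S" "finite c" "c \<noteq> {}" "\<And>P Q. \<lbrakk>P \<in> c; Q \<in> c\<rbrakk> \<Longrightarrow> P \<subseteq> Q \<or> Q \<subseteq> P"
  shows "c \<in> order_complex S"
  using assms by (auto simp: order_complex_def chains_def chain_subset_def)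

context finite_group_prime
begin

abbreviation p_chains :: "'a set set set"
  where "p_chains \<equiv> order_complex p_subgroups"

text \<open>
  The longest initial segment of the chain whose members normalize all smaller members.
\<close>

definition normal_part :: "'a set set \<Rightarrow> 'a set set"
  where "normal_part c = {P \<in> c. \<forall>Q\<in>c. Q \<subseteq> P \<longrightarrow> P \<subseteq> common_normalizer {Q}}"

definition normal_top :: "'a set set \<Rightarrow> 'a set"
  where "normal_top c = \<Union>(normal_part c)"

text \<open>
  The members outside the normal part form a chain, so their intersection is the smallest of them;
  the whole group is included to cover the case that there are none.
\<close>

definition ambient :: "'a set set \<Rightarrow> 'a set"
  where "ambient c = common_normalizer (normal_part c) \<inter> \<Inter>(insert (carrier G) (c - normal_part c))"

definition chain_match :: "'a set set \<Rightarrow> 'a set \<Rightarrow> bool"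
  where "chain_match c R \<longleftrightarrow> c \<in> p_chains \<and> maximal_p_subgroup (ambient c) R \<and> R \<notin> c"

lemma mem_ambient_iff:
  "x \<in> ambient c \<longleftrightarrow> x \<in> carrier G \<and> x \<in> common_normalizer (normal_part c)
     \<and> (\<forall>P\<in>c - normal_part c. x \<in> P)"
  by (auto simp: ambient_def)

lemma p_chain_subgroup:
  assumes "c \<in> p_chains" "P \<in> c"
  shows "P \<in> p_subgroups" "subgroup P G" "P \<subseteq> carrier G"
  using order_complexD(1)[OF assms(1)] assms(2) p_subgroupD by blast+

lemma normal_part_subset: "normal_part c \<subseteq> c"
  by (auto simp: normal_part_def)

lemma normal_part_initial:
  assumes "P \<in> normal_part c" "P' \<in> c" "P' \<subseteq> P"
  shows "P' \<in> normal_part c"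
  using assms unfolding normal_part_def by fastforce

lemma normal_top_mem:
  assumes c: "c \<in> p_chains"
  shows "normal_top c \<in> normal_part c"
  unfolding normal_top_def
proof (rule finite_chain_Union_mem)
  note C = order_complexD[OF c]
  show "finite (normal_part c)" by (rule finite_subset[OF normal_part_subset C(2)])
  obtain M where M: "M \<in> c" "\<And>P. P \<in> c \<Longrightarrow> M \<subseteq> P"
    using finite_chain_least[OF C(2,3,4)] by blast
  have "M \<in> normal_part c"
    unfolding normal_part_def
  proof (safe)
    show "M \<in> c" by (rule M(1))
    fix Q x assume "Q \<in> c" "Q \<subseteq> M" "x \<in> M"
    then have "Q = M" using M(2) by blast
    then show "x \<in> common_normalizer {Q}"
      using subgroup_subset_normalizer[OF p_chain_subgroup(2)[OF c M(1)]] \<open>x \<in> M\<close> by blast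
  qed
  then show "normal_part c \<noteq> {}" by blast
  show "P \<subseteq> Q \<or> Q \<subseteq> P" if "P \<in> normal_part c" "Q \<in> normal_part c" for P Q
    using C(4) that normal_part_subset[of c] by blast
qed

lemma normal_top_upper: "P \<in> normal_part c \<Longrightarrow> P \<subseteq> normal_top c"
  by (auto simp: normal_top_def)

lemma normal_top_in_chain:
  assumes "c \<in> p_chains" shows "normal_top c \<in> c" "normal_top c \<in> p_subgroups"
  using normal_top_mem[OF assms] normal_part_subset p_chain_subgroup(1)[OF assms] by blast+

lemma normal_top_psubset:
  assumes c: "c \<in> p_chains" and P: "P \<in> c - normal_part c"
  shows "normal_top c \<subset> P"
proof -
  have "\<not> P \<subseteq> normal_top c"
    using normal_part_initial[OF normal_top_mem[OF c], of P] P by blast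
  then show ?thesis
    using order_complexD(4)[OF c, of P "normal_top c"] normal_top_in_chain(1)[OF c] P by blast
qed

lemma normal_top_subset_ambient:
  assumes c: "c \<in> p_chains"
  shows "normal_top c \<subseteq> ambient c"
proof
  fix x assume x: "x \<in> normal_top c"
  note T = normal_top_mem[OF c]
  have "x \<in> common_normalizer {Q}" if Q: "Q \<in> normal_part c" for Q
  proof -
    have "normal_top c \<subseteq> common_normalizer {Q}"
      using T normal_top_upper[OF Q] normal_part_subset[of c] Q unfolding normal_part_def by blast
    then show ?thesis using x by blast
  qed
  moreover have xG: "x \<in> carrier G"
    using p_chain_subgroup(3)[OF c normal_top_in_chain(1)[OF c]] x by blast
  ultimately have "x \<in> common_normalizer (normal_part c)"
    using mem_common_normalizer_iff by blast
  then show "x \<in> ambient c"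
    using xG x normal_top_psubset[OF c] unfolding mem_ambient_iff by blast
qed

lemma subgroup_ambient:
  assumes c: "c \<in> p_chains"
  shows "subgroup (ambient c) G"
  unfolding ambient_def
proof (rule subgroups_Inter_pair)
  show "subgroup (common_normalizer (normal_part c)) G"
    by (rule subgroup_common_normalizer) (use p_chain_subgroup(3)[OF c] normal_part_subset in blast)
  show "subgroup (\<Inter>(insert (carrier G) (c - normal_part c))) G"
  proof (rule subgroups_Inter)
    show "subgroup H G" if "H \<in> insert (carrier G) (c - normal_part c)" for H
      using that p_chain_subgroup(2)[OF c] subgroup_self by blast
  qed simp
qed

lemma ambient_subset_rest: "P \<in> c - normal_part c \<Longrightarrow> ambient c \<subseteq> P"
  using mem_ambient_iff by blast

lemma ambient_subset_normalizer: "P \<in> normal_part c \<Longrightarrow> ambient c \<subseteq> common_normalizer {P}"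
  using mem_ambient_iff mem_common_normalizer_iff by blast

text \<open>
  A member of \<open>c\<close> above the normal part contains the ambient subgroup, so it could only be equal to
  it. But then it would normalize every smaller member and belong to the normal part.
\<close>

lemma between_ambient_notin_chain:
  assumes c: "c \<in> p_chains" and R: "normal_top c \<subset> R" "R \<subseteq> ambient c"
  shows "R \<notin> c"
proof
  assume Rc: "R \<in> c"
  have RN: "R \<notin> normal_part c" using normal_top_upper R(1) by blast
  have "R \<subseteq> common_normalizer {Q}" if Q: "Q \<in> c" "Q \<subseteq> R" for Q
  proof (cases "Q \<in> normal_part c")
    case True
    then show ?thesis using ambient_subset_normalizer R(2) by blast
  next
    case False
    then have "Q = R" using ambient_subset_rest[of Q c] Q R(2) by blast
    then show ?thesis using subgroup_subset_normalizer[OF p_chain_subgroup(2)[OF c Rc]] by simp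
  qed
  then show False using Rc RN by (simp add: normal_part_def)
qed

text \<open>
  The last conclusion holds because the ambient subgroup normalizes the normal top: some maximal
  \<open>p\<close>-subgroup of the ambient subgroup contains the normal top, and conjugating it to \<open>R\<close> moves the
  normal top to itself.
\<close>

lemma chain_matchD:
  assumes "chain_match c R"
  shows "c \<in> p_chains" "R \<in> p_subgroups" "R \<notin> c" "R \<subseteq> ambient c" "maximal_p_subgroup (ambient c) R"
    "normal_top c \<subset> R"
proof -
  show c: "c \<in> p_chains" and "R \<notin> c" and R: "maximal_p_subgroup (ambient c) R"
    using assms by (auto simp: chain_match_def)
  then show "R \<in> p_subgroups" "R \<subseteq> ambient c" by (auto simp: maximal_p_subgroup_def)
  let ?T = "normal_top c"
  note T = normal_top_in_chain[OF c]
  obtain Q where Q: "maximal_p_subgroup (ambient c) Q" "?T \<subseteq> Q"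
    using maximal_p_subgroup_exists[OF T(2) normal_top_subset_ambient[OF c] subgroup_ambient[OF c]] .
  obtain g where g: "g \<in> ambient c" "conj_set g Q = R"
    using maximal_p_subgroups_conjugate[OF subgroup_ambient[OF c] Q(1) R] .
  have "g \<in> common_normalizer {?T}"
    using g(1) ambient_subset_normalizer[OF normal_top_mem[OF c]] by blast
  then have "conj_set g ?T = ?T" by (simp add: common_normalizer_def)
  then have "?T \<subseteq> R" using conj_set_mono[OF Q(2), of g] g(2) by simp
  then show "?T \<subset> R" using T(1) \<open>R \<notin> c\<close> by blast
qed

text \<open>
  The new member becomes the top of the normal part and everything above it stays abnormal, so the
  position at which a member was added can be read off from the resulting chain.
\<close>

lemma insert_between:
  assumes c: "c \<in> p_chains" and R: "R \<in> p_subgroups" "normal_top c \<subset> R" "R \<subseteq> ambient c"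
  shows "insert R c \<in> p_chains" "normal_part (insert R c) = insert R (normal_part c)"
    "normal_top (insert R c) = R" "ambient (insert R c) = ambient c \<inter> common_normalizer {R}"
proof -
  have below: "P \<subseteq> R" if "P \<in> normal_part c" for P using normal_top_upper[OF that] R(2) by blast
  have above: "R \<subseteq> P" if "P \<in> c - normal_part c" for P using ambient_subset_rest[OF that] R(3) by blast
  have Rc: "R \<notin> c" by (rule between_ambient_notin_chain[OF c R(2,3)])
  show "insert R c \<in> p_chains"
  proof (rule order_complexI)
    show "P \<subseteq> Q \<or> Q \<subseteq> P" if "P \<in> insert R c" "Q \<in> insert R c" for P Q
      using that below above order_complexD(4)[OF c, of P Q] by blast
  qed (use order_complexD[OF c] R(1) in auto)
  have RN: "R \<subseteq> common_normalizer {Q}" if Q: "Q \<in> insert R c" "Q \<subseteq> R" for Q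
  proof (cases "Q \<in> normal_part c")
    case True
    then show ?thesis using ambient_subset_normalizer R(3) by blast
  next
    case False
    then have "Q = R" using above[of Q] Q by blast
    then show ?thesis using subgroup_subset_normalizer[OF p_subgroupD(1)[OF R(1)]] by simp
  qed
  show np: "normal_part (insert R c) = insert R (normal_part c)"
  proof
    show "normal_part (insert R c) \<subseteq> insert R (normal_part c)"
      by (auto simp: normal_part_def)
    show "insert R (normal_part c) \<subseteq> normal_part (insert R c)"
    proof
      fix P assume P: "P \<in> insert R (normal_part c)"
      show "P \<in> normal_part (insert R c)"
      proof (cases "P = R")
        case True
        then show ?thesis using RN by (simp add: normal_part_def)
      next
        case False
        then have P': "P \<in> normal_part c" using P by simp
        have "\<not> R \<subseteq> P" using normal_top_upper[OF P'] R(2) by blast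
        then show ?thesis using P' by (simp add: normal_part_def)
      qed
    qed
  qed
  show "normal_top (insert R c) = R"
    unfolding normal_top_def np using below by blast
  have "insert R c - insert R (normal_part c) = c - normal_part c" using Rc by blast
  then show "ambient (insert R c) = ambient c \<inter> common_normalizer {R}"
    unfolding ambient_def np using common_normalizer_Un[of "{R}" "normal_part c"] by auto
qed

text \<open>
  The chains that admit no partner above them.
\<close>

definition saturated :: "'a set set \<Rightarrow> bool"
  where "saturated c \<longleftrightarrow> maximal_p_subgroup (ambient c) (normal_top c)"

lemma saturated_iff_unmatched_above:
  assumes c: "c \<in> p_chains"
  shows "saturated c \<longleftrightarrow> \<not> (\<exists>R. chain_match c R)"
proof
  assume s: "saturated c"
  show "\<not> (\<exists>R. chain_match c R)"
  proof
    assume "\<exists>R. chain_match c R"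
    then obtain R where "chain_match c R" by blast
    note R = chain_matchD[OF this]
    have "R = normal_top c"
      using s R(2,4,6) unfolding saturated_def maximal_p_subgroup_def by blast
    then show False using R(6) by blast
  qed
next
  assume no: "\<not> (\<exists>R. chain_match c R)"
  obtain R where R: "maximal_p_subgroup (ambient c) R" "normal_top c \<subseteq> R"
    using maximal_p_subgroup_exists[OF normal_top_in_chain(2)[OF c]
        normal_top_subset_ambient[OF c] subgroup_ambient[OF c]] .
  have "normal_top c = R"
  proof (rule ccontr)
    assume "normal_top c \<noteq> R"
    then have "R \<notin> c"
      using between_ambient_notin_chain[OF c, of R] R by (auto simp: maximal_p_subgroup_def)
    then show False using no c R(1) by (auto simp: chain_match_def)
  qed
  then show "saturated c" using R(1) by (simp add: saturated_def)
qed

lemma chain_match_saturated: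
  assumes "chain_match c R"
  shows "saturated (insert R c)"
proof -
  note R = chain_matchD[OF assms]
  note i = insert_between[OF R(1,2,6,4)]
  show ?thesis
    using R(2,4,5) subgroup_subset_normalizer[OF p_subgroupD(1)[OF R(2)]]
    unfolding saturated_def i(3,4) maximal_p_subgroup_def by blast
qed

text \<open>
  Let \<open>T\<close> be the normal top. Since normalizers grow in \<open>p\<close>-groups, \<open>T\<close> is a maximal \<open>p\<close>-subgroup not
  only of the ambient subgroup but also of the larger group \<open>H0\<close> that arises when \<open>T\<close> itself need not be
  normalized. It remains to see that \<open>H0\<close> is the ambient subgroup of the chain without \<open>T\<close>, that is,
  that removing \<open>T\<close> does not make the next member join the normal part: if it did, this next member
  would be a \<open>p\<close>-subgroup of \<open>H0\<close> that properly contains \<open>T\<close>.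
\<close>

lemma saturated_cases:
  assumes c: "c \<in> p_chains" and s: "saturated c"
  shows "c = {normal_top c} \<and> maximal_p_subgroup (carrier G) (normal_top c)
    \<or> chain_match (c - {normal_top c}) (normal_top c)"
proof -
  define T where "T = normal_top c"
  define A0 where "A0 = normal_part c - {T}"
  (* the ambient subgroup that the chain will have once T is removed *)
  define H0 where "H0 = common_normalizer A0 \<inter> \<Inter>(insert (carrier G) (c - normal_part c))"
  have T: "T \<in> normal_part c" "T \<in> c" "T \<in> p_subgroups" "T \<subseteq> ambient c"
    using normal_top_mem[OF c] normal_top_in_chain[OF c] normal_top_subset_ambient[OF c]
    by (auto simp: T_def)
  have A: "normal_part c = {T} \<union> A0" using T(1) by (auto simp: A0_def)
  have amb: "ambient c = H0 \<inter> common_normalizer {T}"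
    unfolding ambient_def H0_def using common_normalizer_Un[of "{T}" A0] A by auto
  have sT: "maximal_p_subgroup (ambient c) T" using s by (simp add: saturated_def T_def)
  have H0T: "maximal_p_subgroup H0 T"
    unfolding maximal_p_subgroup_def
  proof (intro conjI ballI impI)
    show "T \<in> p_subgroups" by (rule T(3))
    show "T \<subseteq> H0" using T(4) amb by blast
    fix R assume R: "R \<in> p_subgroups" "T \<subseteq> R" "R \<subseteq> H0"
    show "R = T"
    proof (rule ccontr)
      assume "R \<noteq> T"
      then have "T \<subset> R" using R(2) by blast
      then obtain x where x: "x \<in> R - T" "conj_set x T = T"
        using p_subgroup_normalizer_grows[OF T(3) R(1)] by blast
      define Q where "Q = R \<inter> common_normalizer {T}"
      have NT: "subgroup (common_normalizer {T}) G"
        by (rule subgroup_common_normalizer) (use p_subgroupD(2)[OF T(3)] in blast)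
      have "subgroup Q G"
        unfolding Q_def by (rule subgroups_Inter_pair[OF p_subgroupD(1)[OF R(1)] NT])
      moreover have TQ: "T \<subseteq> Q"
        using R(2) subgroup_subset_normalizer[OF p_subgroupD(1)[OF T(3)]] by (auto simp: Q_def)
      ultimately have "Q \<in> p_subgroups"
        using p_subgroup_between[OF T(3) R(1)] by (auto simp: Q_def)
      moreover have "Q \<subseteq> ambient c" using R(3) by (auto simp: Q_def amb)
      ultimately have "Q = T" using sT TQ by (auto simp: maximal_p_subgroup_def)
      moreover have "x \<in> Q"
        using x p_subgroupD(2)[OF R(1)] by (auto simp: Q_def common_normalizer_def)
      ultimately show False using x(1) by blast
    qed
  qed
  have no_norm: "\<not> P \<subseteq> common_normalizer A0" if P: "P \<in> c - normal_part c" for P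
  proof
    assume PA: "P \<subseteq> common_normalizer A0"
    have "finite (c - normal_part c)" "c - normal_part c \<noteq> {}"
      using order_complexD(2)[OF c] P by auto
    then obtain E where E: "E \<in> c - normal_part c" "\<And>P. P \<in> c - normal_part c \<Longrightarrow> E \<subseteq> P"
      using finite_chain_least[of "c - normal_part c"] order_complexD(4)[OF c] by (metis DiffD1)
    have TE: "T \<subset> E" using normal_top_psubset[OF c E(1)] by (simp add: T_def)
    have Ep: "E \<in> p_subgroups" using p_chain_subgroup(1)[OF c] E(1) by blast
    have "E \<subseteq> H0"
      using E(2) E(2)[OF P] PA p_subgroupD(2)[OF Ep] unfolding H0_def by blast
    then have "E = T" using H0T Ep TE by (auto simp: maximal_p_subgroup_def)
    then show False using TE by blast
  qed
  define c0 where "c0 = c - {T}"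
  show ?thesis
  proof (cases "c0 = {}")
    case True
    then have cT: "c = {T}" using T(2) by (auto simp: c0_def)
    then have "normal_part c = {T}" using T(1) normal_part_subset[of c] by blast
    then have "H0 = carrier G"
      using cT by (simp add: H0_def A0_def common_normalizer_def)
    then show ?thesis using cT H0T by (simp add: T_def)
  next
    case False
    have c0: "c0 \<in> p_chains"
    proof (rule order_complexI)
      show "P \<subseteq> Q \<or> Q \<subseteq> P" if "P \<in> c0" "Q \<in> c0" for P Q
        using order_complexD(4)[OF c] that by (simp add: c0_def)
    qed (use order_complexD[OF c] False in \<open>auto simp: c0_def\<close>)
    have np: "normal_part c0 = A0"
    proof
      show "A0 \<subseteq> normal_part c0"
        by (auto simp: A0_def c0_def normal_part_def)
      show "normal_part c0 \<subseteq> A0"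
      proof
        fix P assume P: "P \<in> normal_part c0"
        then have Pc: "P \<in> c" "P \<noteq> T" by (auto simp: normal_part_def c0_def)
        have "P \<in> normal_part c"
        proof (rule ccontr)
          assume "P \<notin> normal_part c"
          then have Pr: "P \<in> c - normal_part c" using Pc by blast
          then have TP: "T \<subset> P" using normal_top_psubset[OF c] by (simp add: T_def)
          have "P \<subseteq> common_normalizer {Q}" if Q: "Q \<in> A0" for Q
          proof -
            have "Q \<in> c0" using Q normal_part_subset[of c] by (auto simp: A0_def c0_def)
            moreover have "Q \<subseteq> P" using normal_top_upper[of Q c] Q TP by (auto simp: A0_def T_def)
            ultimately show ?thesis using P by (simp add: normal_part_def)
          qed
          then have "P \<subseteq> common_normalizer A0"
            using mem_common_normalizer_iff[of _ A0] p_chain_subgroup(3)[OF c Pc(1)] by blast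
          then show False using no_norm[OF Pr] by blast
        qed
        then show "P \<in> A0" using Pc by (simp add: A0_def)
      qed
    qed
    have "c0 - A0 = c - normal_part c" using T(1) by (auto simp: c0_def A0_def)
    then have "ambient c0 = H0" by (simp add: ambient_def H0_def np)
    then have "chain_match c0 T" using c0 H0T by (simp add: chain_match_def c0_def)
    then show ?thesis by (simp add: c0_def T_def)
  qed
qed

lemma conj_set_inj:
  assumes "g \<in> carrier G" "P \<subseteq> carrier G" "Q \<subseteq> carrier G" "conj_set g P = conj_set g Q"
  shows "P = Q"
proof -
  have "P = conj_set (inv g) (conj_set g P)" by (rule conj_set_inv(1)[OF assms(1,2), symmetric])
  also have "\<dots> = conj_set (inv g) (conj_set g Q)" by (simp only: assms(4))
  also have "\<dots> = Q" by (rule conj_set_inv(1)[OF assms(1,3)])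
  finally show ?thesis .
qed

lemma conj_chain:
  assumes c: "c \<in> p_chains" and g: "g \<in> carrier G"
  shows "conj_set g ` c \<in> p_chains"
proof (rule order_complexI)
  show "conj_set g ` c \<subseteq> p_subgroups"
    using p_chain_subgroup(1)[OF c] p_subgroup_conj_set[OF _ g] by blast
  show "P \<subseteq> Q \<or> Q \<subseteq> P" if PQ: "P \<in> conj_set g ` c" "Q \<in> conj_set g ` c" for P Q
  proof -
    obtain P' Q' where "P' \<in> c" "Q' \<in> c" "P = conj_set g P'" "Q = conj_set g Q'" using PQ by blast
    then show ?thesis using order_complexD(4)[OF c] conj_set_mono by metis
  qed
qed (use order_complexD[OF c] in auto)

lemma normal_part_conj:
  assumes c: "c \<in> p_chains" and g: "g \<in> carrier G"
  shows "normal_part (conj_set g ` c) = conj_set g ` normal_part c"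
proof -
  have eq: "(\<forall>Q\<in>conj_set g ` c. Q \<subseteq> conj_set g P \<longrightarrow> conj_set g P \<subseteq> common_normalizer {Q})
      \<longleftrightarrow> (\<forall>Q\<in>c. Q \<subseteq> P \<longrightarrow> P \<subseteq> common_normalizer {Q})" if P: "P \<in> c" for P
  proof -
    have iff: "(conj_set g Q \<subseteq> conj_set g P \<longrightarrow> conj_set g P \<subseteq> common_normalizer {conj_set g Q})
      \<longleftrightarrow> (Q \<subseteq> P \<longrightarrow> P \<subseteq> common_normalizer {Q})" if Q: "Q \<in> c" for Q
    proof -
      have PQ: "P \<subseteq> carrier G" "Q \<subseteq> carrier G" using p_chain_subgroup(3)[OF c] P Q by auto
      have N: "common_normalizer {conj_set g Q} = conj_set g (common_normalizer {Q})"
        using conj_set_common_normalizer[OF g, of "{Q}"] PQ by simp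
      have NG: "common_normalizer {Q} \<subseteq> carrier G" by (auto simp: common_normalizer_def)
      show ?thesis unfolding N using conj_set_subset_iff[OF g] PQ NG by simp
    qed
    have image: "(\<forall>Q\<in>f ` c. \<Phi> Q) \<longleftrightarrow> (\<forall>Q\<in>c. \<Phi> (f Q))" for f :: "'a set \<Rightarrow> 'a set" and \<Phi>
      by blast
    show ?thesis unfolding image by (rule ball_cong[OF refl iff])
  qed
  show ?thesis
    unfolding normal_part_def
  proof (intro equalityI subsetI)
    fix P assume "P \<in> conj_set g ` {P \<in> c. \<forall>Q\<in>c. Q \<subseteq> P \<longrightarrow> P \<subseteq> common_normalizer {Q}}"
    then obtain P' where "P' \<in> c" "P = conj_set g P'" "\<forall>Q\<in>c. Q \<subseteq> P' \<longrightarrow> P' \<subseteq> common_normalizer {Q}"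
      by auto
    then show "P \<in> {P \<in> conj_set g ` c. \<forall>Q\<in>conj_set g ` c. Q \<subseteq> P \<longrightarrow> P \<subseteq> common_normalizer {Q}}"
      using eq[of P'] by simp
  next
    fix P assume "P \<in> {P \<in> conj_set g ` c. \<forall>Q\<in>conj_set g ` c. Q \<subseteq> P \<longrightarrow> P \<subseteq> common_normalizer {Q}}"
    then obtain P' where "P' \<in> c" "P = conj_set g P'"
      "\<forall>Q\<in>conj_set g ` c. Q \<subseteq> conj_set g P' \<longrightarrow> conj_set g P' \<subseteq> common_normalizer {Q}"
      by auto
    then show "P \<in> conj_set g ` {P \<in> c. \<forall>Q\<in>c. Q \<subseteq> P \<longrightarrow> P \<subseteq> common_normalizer {Q}}"
      using eq[of P'] by simp
  qed
qed

lemma ambient_conj: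
  assumes c: "c \<in> p_chains" and g: "g \<in> carrier G"
  shows "ambient (conj_set g ` c) = conj_set g (ambient c)"
proof -
  have PG: "P \<subseteq> carrier G" if "P \<in> c" for P using p_chain_subgroup(3)[OF c that] .
  have ag: "ambient c \<subseteq> carrier G" by (auto simp: ambient_def)
  have ag': "ambient (conj_set g ` c) \<subseteq> carrier G" by (auto simp: ambient_def)
  have cg: "conj_set g (ambient c) \<subseteq> carrier G" by (rule conj_set_subset_carrier[OF g ag])
  have rest: "conj_set g ` c - conj_set g ` normal_part c = conj_set g ` (c - normal_part c)"
  proof -
    have "inj_on (conj_set g) c" by (rule inj_onI) (use conj_set_inj[OF g] PG in blast)
    then show ?thesis using inj_on_image_set_diff[of "conj_set g" c c "normal_part c"] normal_part_subset[of c]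
      by blast
  qed
  have norm: "common_normalizer (conj_set g ` normal_part c) = conj_set g (common_normalizer (normal_part c))"
    by (rule conj_set_common_normalizer[OF g, symmetric]) (use PG normal_part_subset in blast)
  have "x \<in> ambient (conj_set g ` c) \<longleftrightarrow> x \<in> conj_set g (ambient c)" if x: "x \<in> carrier G" for x
  proof -
    let ?y = "inv g \<otimes> x \<otimes> g"
    have y: "?y \<in> carrier G" using x g by simp
    have NG: "common_normalizer (normal_part c) \<subseteq> carrier G" by (auto simp: common_normalizer_def)
    have "x \<in> ambient (conj_set g ` c) \<longleftrightarrow>
        x \<in> conj_set g (common_normalizer (normal_part c)) \<and> (\<forall>P\<in>c - normal_part c. x \<in> conj_set g P)"
      unfolding mem_ambient_iff normal_part_conj[OF c g] rest norm using x by simp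
    also have "\<dots> \<longleftrightarrow> ?y \<in> common_normalizer (normal_part c) \<and> (\<forall>P\<in>c - normal_part c. ?y \<in> P)"
      using mem_conj_set_iff[OF g x NG] mem_conj_set_iff[OF g x PG] by simp
    also have "\<dots> \<longleftrightarrow> ?y \<in> ambient c" using y by (simp add: mem_ambient_iff)
    also have "\<dots> \<longleftrightarrow> x \<in> conj_set g (ambient c)" using mem_conj_set_iff[OF g x ag] by simp
    finally show ?thesis .
  qed
  then show ?thesis using ag' cg by blast
qed

lemma chain_match_conj:
  assumes m: "chain_match c R" and g: "g \<in> carrier G"
  shows "chain_match (conj_set g ` c) (conj_set g R)"
proof -
  note R = chain_matchD[OF m]
  have "ambient c \<subseteq> carrier G" by (auto simp: ambient_def)
  then have "maximal_p_subgroup (ambient (conj_set g ` c)) (conj_set g R)"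
    unfolding ambient_conj[OF R(1) g] by (rule maximal_p_subgroup_conj_set[OF _ R(5) g])
  moreover have "conj_set g R \<notin> conj_set g ` c"
  proof
    assume "conj_set g R \<in> conj_set g ` c"
    then obtain P where P: "P \<in> c" "conj_set g R = conj_set g P" by blast
    then have "R = P"
      using conj_set_inj[OF g p_subgroupD(2)[OF R(2)] p_chain_subgroup(3)[OF R(1) P(1)]] by blast
    then show False using P R(3) by blast
  qed
  ultimately show ?thesis using conj_chain[OF R(1) g] by (simp add: chain_match_def)
qed

text \<open>
  Two candidates are conjugate in the ambient subgroup, each element of which normalizes the normal
  part and lies in, hence normalizes, every other member.
\<close>

lemma chain_match_unique_up_to_conj:
  assumes m: "chain_match c R" "chain_match c R'"
  shows "\<exists>g\<in>carrier G. conj_set g ` c = c \<and> conj_set g R = R'"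
proof -
  note R = chain_matchD[OF m(1)] and R' = chain_matchD[OF m(2)]
  obtain g where g: "g \<in> ambient c" "conj_set g R = R'"
    using maximal_p_subgroups_conjugate[OF subgroup_ambient[OF R(1)] R(5) R'(5)] .
  have "conj_set g P = P" if P: "P \<in> c" for P
  proof (cases "P \<in> normal_part c")
    case True
    then have "g \<in> common_normalizer {P}" using ambient_subset_normalizer g(1) by blast
    then show ?thesis by (simp add: common_normalizer_def)
  next
    case False
    then have "g \<in> P" using P g(1) mem_ambient_iff by blast
    then show ?thesis by (rule conj_set_self[OF p_chain_subgroup(2)[OF R(1) P]])
  qed
  then have "conj_set g ` c = c" by simp
  moreover have "g \<in> carrier G" using g(1) mem_ambient_iff by blast
  ultimately show ?thesis using g(2) by blast
qed

text \<open>
  The added member is the normal top of the larger chain.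
\<close>

lemma chain_match_lower_unique:
  assumes m: "chain_match c R" "chain_match c' R'" and eq: "insert R c = insert R' c'"
  shows "c = c'"
proof -
  note R = chain_matchD[OF m(1)] and R' = chain_matchD[OF m(2)]
  have "R = R'"
    using insert_between(3)[OF R(1,2,6,4)] insert_between(3)[OF R'(1,2,6,4)] eq by simp
  have "c = insert R c - {R}" using R(3) by simp
  also have "\<dots> = insert R' c' - {R'}" using eq \<open>R = R'\<close> by simp
  also have "\<dots> = c'" using R'(3) by simp
  finally show ?thesis .
qed

text \<open>
  The subgroup \<open>R\<close> stays in the normal part when smaller or larger members are removed.
\<close>

lemma normal_top_grows:
  assumes m: "chain_match c R" and P: "P \<in> c"
  shows "card (normal_top c) < card (normal_top (insert R c - {P}))"
proof -
  note R = chain_matchD[OF m]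
  let ?d = "insert R c - {P}"
  have Rd: "R \<in> ?d" using P R(3) by blast
  have "R \<in> normal_part (insert R c)" using insert_between(2)[OF R(1,2,6,4)] by simp
  then have "R \<in> normal_part ?d" using Rd by (auto simp: normal_part_def)
  then have "R \<subseteq> normal_top ?d" by (rule normal_top_upper)
  moreover have "finite (normal_top ?d)"
  proof (rule finite_subset[OF _ finite_carrier])
    have "normal_top ?d \<subseteq> \<Union>(insert R c)" using normal_part_subset[of ?d] unfolding normal_top_def by blast
    also have "\<dots> \<subseteq> carrier G" using p_subgroupD(2)[OF R(2)] p_chain_subgroup(3)[OF R(1)] by blast
    finally show "normal_top ?d \<subseteq> carrier G" .
  qed
  ultimately have "card R \<le> card (normal_top ?d)" by (intro card_mono)
  moreover have "card (normal_top c) < card R"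
    by (rule psubset_card_mono[OF p_subgroupD(3)[OF R(2)] R(6)])
  ultimately show ?thesis by simp
qed

lemma p_chain_cases:
  assumes c: "c \<in> p_chains"
  shows "(\<exists>R. chain_match c R) \<or> (\<exists>c' R. chain_match c' R \<and> c = insert R c')
    \<or> (\<exists>T. c = {T} \<and> maximal_p_subgroup (carrier G) T)"
proof (cases "saturated c")
  case True
  have "c = insert (normal_top c) (c - {normal_top c})" using normal_top_in_chain(1)[OF c] by blast
  then show ?thesis using saturated_cases[OF c True] by blast
next
  case False
  then show ?thesis using saturated_iff_unmatched_above[OF c] by blast
qed

lemma singleton_sylow_unmatched:
  assumes T: "maximal_p_subgroup (carrier G) T"
  shows "\<not> chain_match {T} R"
proof
  assume "chain_match {T} R"
  note R = chain_matchD[OF this]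
  have "normal_top {T} = T" using normal_top_in_chain(1)[OF R(1)] by simp
  moreover have "R \<subseteq> carrier G" by (rule p_subgroupD(2)[OF R(2)])
  ultimately show False using T R(2,6) by (auto simp: maximal_p_subgroup_def)
qed

end

section \<open>Points of a realization\<close>

abbreviation support :: "('v \<Rightarrow> real) \<Rightarrow> 'v set"
  where "support x \<equiv> {v. x v \<noteq> 0}"

lemma support_restrict_eq: "support x \<subseteq> \<tau> \<Longrightarrow> finite \<tau> \<Longrightarrow> sum x (support x) = sum x \<tau>"
  by (rule sum.mono_neutral_left) auto

lemma realization_points_subset:
  "L \<subseteq> K \<Longrightarrow> realization_points L = {x \<in> realization_points K. support x \<in> L}"
  by (auto simp: realization_points_def)

lemma continuous_on_Min_family:
  fixes f :: "'a::topological_space \<Rightarrow> 'i \<Rightarrow> real"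
  assumes "finite I" "I \<noteq> {}" "\<And>i. i \<in> I \<Longrightarrow> continuous_on A (\<lambda>x. f x i)"
  shows "continuous_on A (\<lambda>x. Min (f x ` I))"
  using assms
proof (induction rule: finite_ne_induct)
  case (insert i I)
  then have "continuous_on A (\<lambda>x. min (f x i) (Min (f x ` I)))"
    by (intro continuous_on_min) auto
  then show ?case using insert by simp
qed simp

section \<open>Pushing a simplex away from a face\<close>

text \<open>
  Weight flows from the vertices of \<open>\<sigma>\<close> at equal speed to the vertex \<open>r\<close>, such that at time one the
  vertex of \<open>\<sigma>\<close> with the least weight has just been emptied.
\<close>

definition push :: "'v set \<Rightarrow> 'v \<Rightarrow> real \<Rightarrow> ('v \<Rightarrow> real) \<Rightarrow> 'v \<Rightarrow> real" where
  "push \<sigma> r t x = (\<lambda>v. if v \<in> \<sigma> then x v - t * Min (x ` \<sigma>)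
     else if v = r then x r + t * real (card \<sigma>) * Min (x ` \<sigma>) else x v)"

lemma push_0: "push \<sigma> r 0 x = x"
  by (auto simp: push_def)

text \<open>
  The part of the simplex onto which it is retracted stays fixed.
\<close>

lemma push_stationary:
  assumes "finite \<sigma>" "\<And>v. 0 \<le> x v" "\<not> \<sigma> \<subseteq> support x"
  shows "push \<sigma> r t x = x"
proof -
  have "Min (x ` \<sigma>) = 0"
    using assms by (intro Min_eqI) (auto simp: image_iff)
  then show ?thesis by (auto simp: push_def)
qed

lemma push_1_not_full:
  assumes "finite \<sigma>" "\<sigma> \<noteq> {}"
  shows "\<not> \<sigma> \<subseteq> support (push \<sigma> r 1 x)"
proof -
  have "Min (x ` \<sigma>) \<in> x ` \<sigma>" using assms by simp
  then obtain v where "v \<in> \<sigma>" "Min (x ` \<sigma>) = x v" by auto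
  then have "v \<in> \<sigma>" "push \<sigma> r 1 x v = 0" by (simp_all add: push_def)
  then show ?thesis by blast
qed

lemma push_nonneg:
  assumes "finite \<sigma>" "\<And>v. 0 \<le> x v" "0 \<le> t" "t \<le> 1"
  shows "0 \<le> push \<sigma> r t x v"
proof (cases "v \<in> \<sigma>")
  case True
  then have "\<sigma> \<noteq> {}" by auto
  then have m: "0 \<le> Min (x ` \<sigma>)" "Min (x ` \<sigma>) \<le> x v" using assms True by simp_all
  have "t * Min (x ` \<sigma>) \<le> Min (x ` \<sigma>)" using m(1) assms by (simp add: mult_left_le_one_le)
  then show ?thesis using m True by (simp add: push_def)
next
  case False
  show ?thesis
  proof (cases "\<sigma> = {}")
    case True then show ?thesis using assms by (simp add: push_def)
  next
    case ne: False
    then have "0 \<le> Min (x ` \<sigma>)" using assms by simp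
    then show ?thesis using False assms by (simp add: push_def)
  qed
qed

lemma sum_push:
  assumes "finite \<sigma>" "r \<notin> \<sigma>"
  shows "sum (push \<sigma> r t x) (insert r \<sigma>) = sum x (insert r \<sigma>)"
proof -
  have "sum (push \<sigma> r t x) \<sigma> = (\<Sum>v\<in>\<sigma>. x v - t * Min (x ` \<sigma>))"
    by (rule sum.cong) (auto simp: push_def)
  then show ?thesis
    using assms by (simp add: sum_subtractf) (simp add: push_def)
qed

lemma support_push:
  assumes "support x \<subseteq> insert r \<sigma>"
  shows "support (push \<sigma> r t x) \<subseteq> insert r \<sigma>"
  using assms by (auto simp: push_def)

lemma continuous_on_push:
  assumes "finite \<sigma>" "\<sigma> \<noteq> {}" and t: "continuous_on A t" and x: "continuous_on A x"
  shows "continuous_on A (\<lambda>z. push \<sigma> r (t z) (x z))"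
proof (rule continuous_on_coordinatewise_then_product)
  fix v
  have [continuous_intros]: "continuous_on A (\<lambda>z. x z w)" for w
    using x by (rule continuous_on_product_then_coordinatewise)
  have [continuous_intros]: "continuous_on A (\<lambda>z. Min (x z ` \<sigma>))"
    by (rule continuous_on_Min_family) (use assms in \<open>auto intro: continuous_intros\<close>)
  show "continuous_on A (\<lambda>z. push \<sigma> r (t z) (x z) v)"
    unfolding push_def
    by (cases "v \<in> \<sigma>"; cases "v = r") (auto intro!: continuous_intros t)
qed

section \<open>Regular actions and their orbit spaces\<close>

text \<open>
  The assumption \<open>regular\<close> says that no element moves a vertex to a different vertex of a common
  simplex. Every simplex then embeds into the orbit space.
\<close>

locale regular_complex = group G for G :: "('g, 'm) monoid_scheme" (structure) +
  fixes K :: "'v set set" and \<phi> :: "'g \<Rightarrow> 'v \<Rightarrow> 'v"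
  assumes finite_carrier: "finite (carrier G)"
    and finite_K: "finite K"
    and finite_simplex: "\<sigma> \<in> K \<Longrightarrow> finite \<sigma>"
    and empty_notin_K: "{} \<notin> K"
    and face: "\<lbrakk>\<sigma> \<in> K; \<rho> \<subseteq> \<sigma>; \<rho> \<noteq> {}\<rbrakk> \<Longrightarrow> \<rho> \<in> K"
    and image_simplex: "\<lbrakk>g \<in> carrier G; \<sigma> \<in> K\<rbrakk> \<Longrightarrow> \<phi> g ` \<sigma> \<in> K"
    and vertex_one: "v \<in> \<Union>K \<Longrightarrow> \<phi> \<one> v = v"
    and vertex_mult: "\<lbrakk>g \<in> carrier G; h \<in> carrier G; v \<in> \<Union>K\<rbrakk> \<Longrightarrow> \<phi> (g \<otimes> h) v = \<phi> g (\<phi> h v)"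
    and regular: "\<lbrakk>g \<in> carrier G; \<sigma> \<in> K; v \<in> \<sigma>; \<phi> g v \<in> \<sigma>\<rbrakk> \<Longrightarrow> \<phi> g v = v"
begin

lemma vertex_closed: "g \<in> carrier G \<Longrightarrow> v \<in> \<Union>K \<Longrightarrow> \<phi> g v \<in> \<Union>K"
  using image_simplex by blast

lemma vertex_inv:
  assumes "g \<in> carrier G" "v \<in> \<Union>K"
  shows "\<phi> (inv g) (\<phi> g v) = v" "\<phi> g (\<phi> (inv g) v) = v"
  using vertex_mult[OF inv_closed[OF assms(1)] assms] vertex_mult[OF assms(1) inv_closed[OF assms(1)] assms(2)]
    vertex_one[OF assms(2)] assms(1) by auto

lemma inj_on_vertex: "g \<in> carrier G \<Longrightarrow> inj_on (\<phi> g) (\<Union>K)"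
  by (metis inj_onI vertex_inv(1))

lemma image_mult:
  assumes "g \<in> carrier G" "h \<in> carrier G" "\<sigma> \<subseteq> \<Union>K"
  shows "\<phi> g ` \<phi> h ` \<sigma> = \<phi> (g \<otimes> h) ` \<sigma>"
proof -
  have "\<phi> g (\<phi> h v) = \<phi> (g \<otimes> h) v" if "v \<in> \<sigma>" for v
    by (rule vertex_mult[OF assms(1,2), symmetric]) (use assms(3) that in blast)
  then show ?thesis by (simp add: image_image)
qed

lemma image_one: "\<sigma> \<subseteq> \<Union>K \<Longrightarrow> \<phi> \<one> ` \<sigma> = \<sigma>"
proof -
  assume "\<sigma> \<subseteq> \<Union>K"
  then have "\<phi> \<one> ` \<sigma> = (\<lambda>v. v) ` \<sigma>"
    by (intro image_cong[OF refl] vertex_one) blast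
  then show ?thesis by simp
qed

lemma image_inv:
  assumes "g \<in> carrier G" "\<sigma> \<subseteq> \<Union>K"
  shows "\<phi> (inv g) ` \<phi> g ` \<sigma> = \<sigma>" "\<phi> g ` \<phi> (inv g) ` \<sigma> = \<sigma>"
  using assms by (simp_all add: image_mult image_one)

lemma card_image_simplex: "g \<in> carrier G \<Longrightarrow> \<sigma> \<in> K \<Longrightarrow> card (\<phi> g ` \<sigma>) = card \<sigma>"
  by (rule card_image, rule inj_on_subset[OF inj_on_vertex]) auto

lemma image_simplex_eq:
  assumes "g \<in> carrier G" "\<tau> \<in> K" "\<sigma> \<subseteq> \<tau>" "\<phi> g ` \<sigma> \<subseteq> \<tau>"
  shows "\<phi> g ` \<sigma> = \<sigma>"
proof -
  have "\<phi> g v = v" if "v \<in> \<sigma>" for v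
    by (rule regular[OF assms(1,2)]) (use that assms in auto)
  then show ?thesis by simp
qed

text \<open>
  The action on points in coordinates: on the realization it agrees with the linear extension of the
  vertex maps, but continuity and the action laws are visible.
\<close>

definition act :: "'g \<Rightarrow> ('v \<Rightarrow> real) \<Rightarrow> 'v \<Rightarrow> real"
  where "act g x = (\<lambda>w. if w \<in> \<Union>K then x (\<phi> (inv g) w) else 0)"

abbreviation points :: "('v \<Rightarrow> real) set"
  where "points \<equiv> realization_points K"

lemma pointD:
  assumes "x \<in> points"
  shows "\<And>v. 0 \<le> x v" "support x \<in> K" "support x \<subseteq> \<Union>K" "sum x (support x) = 1"
    "support x \<noteq> {}"
proof -
  show s: "support x \<in> K" using assms by (simp add: realization_points_def)
  show "support x \<noteq> {}"
  proof
    assume "support x = {}"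
    with s show False using empty_notin_K by argo
  qed
  show "support x \<subseteq> \<Union>K" using s by blast
qed (use assms in \<open>auto simp: realization_points_def\<close>)

lemma pointI:
  assumes "\<And>v. 0 \<le> x v" "\<tau> \<in> K" "support x \<subseteq> \<tau>" "sum x \<tau> = 1"
  shows "x \<in> points"
proof -
  have 1: "sum x (support x) = 1" using assms support_restrict_eq[of x \<tau>] finite_simplex by simp
  then have "support x \<noteq> {}" by (metis sum.empty zero_neq_one)
  then have "support x \<in> K" using assms face by blast
  then show ?thesis using assms(1) 1 by (simp add: realization_points_def)
qed

lemma realization_map_eq_act:
  assumes x: "x \<in> points" and g: "g \<in> carrier G"
  shows "realization_map (\<phi> g) x = act g x"
proof
  fix w
  have sub: "support x \<subseteq> \<Union>K" by (rule pointD[OF x])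
  show "realization_map (\<phi> g) x w = act g x w"
  proof (cases "w \<in> \<Union>K \<and> x (\<phi> (inv g) w) \<noteq> 0")
    case True
    have "v = \<phi> (inv g) w" if "x v \<noteq> 0" "\<phi> g v = w" for v
    proof -
      have "v \<in> \<Union>K" using that(1) sub by blast
      then show ?thesis using vertex_inv(1)[OF g] that(2) by metis
    qed
    moreover have "\<phi> g (\<phi> (inv g) w) = w" using vertex_inv(2)[OF g] True by blast
    ultimately have "{v. x v \<noteq> 0 \<and> \<phi> g v = w} = {\<phi> (inv g) w}"
      using True by blast
    then show ?thesis using True by (simp add: realization_map_def act_def)
  next
    case False
    have "{v. x v \<noteq> 0 \<and> \<phi> g v = w} = {}"
    proof (rule ccontr)
      assume "{v. x v \<noteq> 0 \<and> \<phi> g v = w} \<noteq> {}"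
      then obtain v where v: "x v \<noteq> 0" "\<phi> g v = w" by blast
      then have "v \<in> \<Union>K" using sub by blast
      then have "\<phi> (inv g) w = v" "w \<in> \<Union>K"
        using vertex_inv(1)[OF g, of v] vertex_closed[OF g, of v] v(2) by blast+
      then show False using False v(1) by blast
    qed
    then have "realization_map (\<phi> g) x w = 0" unfolding realization_map_def by (simp only: sum.empty)
    then show ?thesis using False by (auto simp: act_def)
  qed
qed

lemma support_act:
  assumes "x \<in> points" "g \<in> carrier G"
  shows "support (act g x) = \<phi> g ` support x"
proof -
  have sub: "support x \<subseteq> \<Union>K" by (rule pointD[OF assms(1)])
  show ?thesis
  proof
    show "support (act g x) \<subseteq> \<phi> g ` support x"
    proof
      fix w assume "w \<in> support (act g x)"
      then have w: "w \<in> \<Union>K" "x (\<phi> (inv g) w) \<noteq> 0" by (auto simp: act_def split: if_splits)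
      have "w = \<phi> g (\<phi> (inv g) w)" using vertex_inv(2)[OF assms(2) w(1)] by simp
      then show "w \<in> \<phi> g ` support x" using w(2) by blast
    qed
    show "\<phi> g ` support x \<subseteq> support (act g x)"
    proof
      fix w assume "w \<in> \<phi> g ` support x"
      then obtain v where v: "v \<in> support x" "w = \<phi> g v" by blast
      then have vK: "v \<in> \<Union>K" using sub by blast
      have "act g x w = x v"
        using vertex_inv(1)[OF assms(2) vK] vertex_closed[OF assms(2) vK] v(2) by (simp add: act_def)
      then show "w \<in> support (act g x)" using v(1) by simp
    qed
  qed
qed

lemma act_points:
  assumes x: "x \<in> points" and g: "g \<in> carrier G"
  shows "act g x \<in> points"
proof (rule pointI)
  show "0 \<le> act g x v" for v using pointD(1)[OF x] by (simp add: act_def)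
  show "\<phi> g ` support x \<in> K" by (rule image_simplex[OF g pointD(2)[OF x]])
  show "support (act g x) \<subseteq> \<phi> g ` support x" using support_act[OF x g] by simp
  have sub: "support x \<subseteq> \<Union>K" by (rule pointD[OF x])
  have "sum (act g x) (\<phi> g ` support x) = (\<Sum>v\<in>support x. act g x (\<phi> g v))"
    by (rule sum.reindex_cong[OF inj_on_subset[OF inj_on_vertex[OF g] sub]]) auto
  also have "\<dots> = sum x (support x)"
  proof (rule sum.cong[OF refl])
    fix v assume "v \<in> support x"
    then have "v \<in> \<Union>K" using sub by blast
    then show "act g x (\<phi> g v) = x v"
      using vertex_inv(1)[OF g] vertex_closed[OF g] by (simp add: act_def)
  qed
  finally show "sum (act g x) (\<phi> g ` support x) = 1" using pointD(4)[OF x] by simp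
qed

lemma act_one:
  assumes "x \<in> points" shows "act \<one> x = x"
proof
  fix w show "act \<one> x w = x w"
    using pointD(3)[OF assms] vertex_one[of w] by (auto simp: act_def)
qed

lemma act_mult:
  assumes g: "g \<in> carrier G" and h: "h \<in> carrier G"
  shows "act (g \<otimes> h) x = act g (act h x)"
proof
  fix w
  show "act (g \<otimes> h) x w = act g (act h x) w"
  proof (cases "w \<in> \<Union>K")
    case True
    have "\<phi> (inv (g \<otimes> h)) w = \<phi> (inv h) (\<phi> (inv g) w)"
      using vertex_mult[OF inv_closed[OF h] inv_closed[OF g] True] g h by (simp add: inv_mult_group)
    then show ?thesis using True vertex_closed[OF inv_closed[OF g] True] by (simp add: act_def)
  qed (simp add: act_def)
qed

lemma act_inv:
  assumes "x \<in> points" "g \<in> carrier G"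
  shows "act (inv g) (act g x) = x" "act g (act (inv g) x) = x"
  using assms act_mult[of "inv g" g x] act_mult[of g "inv g" x] act_one by auto

text \<open>
  Each closed simplex meets every orbit at most once.
\<close>

lemma act_eq_self:
  assumes x: "x \<in> points" and g: "g \<in> carrier G" and \<tau>: "\<tau> \<in> K"
    and sx: "support x \<subseteq> \<tau>" and sg: "support (act g x) \<subseteq> \<tau>"
  shows "act g x = x"
proof
  fix w
  have fix_v: "\<phi> g v = v" if "v \<in> support x" for v
    by (rule regular[OF g \<tau>]) (use that sx sg support_act[OF x g] in auto)
  then have s: "support (act g x) = support x" using support_act[OF x g] by simp
  show "act g x w = x w"
  proof (cases "w \<in> support x")
    case True
    then have w: "w \<in> \<Union>K" using pointD(3)[OF x] by blast
    have "\<phi> (inv g) w = w" using vertex_inv(1)[OF g w] fix_v[OF True] by simp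
    then show ?thesis using w by (simp add: act_def)
  next
    case False
    then show ?thesis using s by auto
  qed
qed

lemma continuous_on_act: "continuous_on A (act g)"
proof (rule continuous_on_coordinatewise_then_product)
  fix w
  show "continuous_on A (\<lambda>x. act g x w)"
    unfolding act_def
    by (cases "w \<in> \<Union>K")
      (auto intro: continuous_on_subset[OF continuous_on_product_coordinates])
qed

abbreviation proj :: "('v \<Rightarrow> real) \<Rightarrow> ('v \<Rightarrow> real) set"
  where "proj \<equiv> orbit G (\<lambda>g. realization_map (\<phi> g))"

abbreviation orbits_space :: "('v \<Rightarrow> real) set topology"
  where "orbits_space \<equiv> orbit_space G (geometric_realization K) (\<lambda>g. realization_map (\<phi> g))"

lemma proj_eq_image: "x \<in> points \<Longrightarrow> proj x = (\<lambda>g. act g x) ` carrier G"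
  unfolding orbit_def setcompr_eq_image Collect_mem_eq by (simp add: realization_map_eq_act)

lemma proj_act:
  assumes x: "x \<in> points" and g: "g \<in> carrier G"
  shows "proj (act g x) = proj x"
proof -
  have "(\<lambda>h. act h (act g x)) ` carrier G = (\<lambda>h. act h x) ` carrier G"
  proof
    show "(\<lambda>h. act h (act g x)) ` carrier G \<subseteq> (\<lambda>h. act h x) ` carrier G"
      using g by (auto simp flip: act_mult)
    show "(\<lambda>h. act h x) ` carrier G \<subseteq> (\<lambda>h. act h (act g x)) ` carrier G"
    proof
      fix y assume "y \<in> (\<lambda>h. act h x) ` carrier G"
      then obtain h where h: "h \<in> carrier G" "y = act h x" by blast
      have "act (h \<otimes> inv g) (act g x) = act h x"
        using h g x by (simp add: act_mult act_inv)
      then show "y \<in> (\<lambda>h. act h (act g x)) ` carrier G"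
        using h g by (metis image_eqI inv_closed m_closed)
    qed
  qed
  then show ?thesis using proj_eq_image x act_points[OF x g] by simp
qed

lemma proj_eqD:
  assumes x: "x \<in> points" and y: "y \<in> points" and eq: "proj x = proj y"
  obtains g where "g \<in> carrier G" "y = act g x"
proof -
  have "y \<in> proj y" unfolding proj_eq_image[OF y]
    by (rule image_eqI[of _ _ \<one>]) (simp_all add: act_one[OF y])
  then have "y \<in> (\<lambda>g. act g x) ` carrier G" using eq proj_eq_image[OF x] by simp
  then show thesis using that by blast
qed

definition subcomplex :: "'v set set \<Rightarrow> bool"
  where "subcomplex L \<longleftrightarrow> L \<subseteq> K \<and> (\<forall>\<sigma>\<in>L. \<forall>\<rho>\<subseteq>\<sigma>. \<rho> \<noteq> {} \<longrightarrow> \<rho> \<in> L)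
     \<and> (\<forall>g\<in>carrier G. \<forall>\<sigma>\<in>L. \<phi> g ` \<sigma> \<in> L)"

lemma subcomplexD:
  assumes "subcomplex L"
  shows "L \<subseteq> K" "\<And>\<sigma> \<rho>. \<lbrakk>\<sigma> \<in> L; \<rho> \<subseteq> \<sigma>; \<rho> \<noteq> {}\<rbrakk> \<Longrightarrow> \<rho> \<in> L"
    "\<And>g \<sigma>. \<lbrakk>g \<in> carrier G; \<sigma> \<in> L\<rbrakk> \<Longrightarrow> \<phi> g ` \<sigma> \<in> L"
  using assms by (auto simp: subcomplex_def)

lemma subcomplex_K: "subcomplex K"
  using face image_simplex by (auto simp: subcomplex_def)

lemma points_subcomplex:
  "subcomplex L \<Longrightarrow> realization_points L = {x \<in> points. support x \<in> L}"
  by (rule realization_points_subset) (simp add: subcomplexD)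

lemma act_points_subcomplex:
  assumes "subcomplex L" "x \<in> realization_points L" "g \<in> carrier G"
  shows "act g x \<in> realization_points L"
  using assms by (simp add: points_subcomplex act_points support_act subcomplexD)

lemma closed_support_subset: "closed {x :: 'v \<Rightarrow> real. support x \<subseteq> \<tau>}"
proof -
  have "{x :: 'v \<Rightarrow> real. support x \<subseteq> \<tau>} = (\<Inter>v\<in>-\<tau>. {x. x v = 0})" by auto
  moreover have "closed {x :: 'v \<Rightarrow> real. x v = 0}" for v
    by (rule closed_Collect_eq) (auto intro: continuous_intros)
  ultimately show ?thesis by auto
qed

text \<open>
  A subcomplex is the union of its finitely many closed simplices.
\<close>

lemma closedin_points_subcomplex:
  assumes "subcomplex L" "subcomplex M" "L \<subseteq> M"
  shows "closedin (top_of_set (realization_points M)) (realization_points L)"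
proof -
  have "realization_points L = realization_points M \<inter> (\<Union>\<tau>\<in>L. {x. support x \<subseteq> \<tau>})"
  proof
    show "realization_points L \<subseteq> realization_points M \<inter> (\<Union>\<tau>\<in>L. {x. support x \<subseteq> \<tau>})"
      using assms by (auto simp: points_subcomplex)
    show "realization_points M \<inter> (\<Union>\<tau>\<in>L. {x. support x \<subseteq> \<tau>}) \<subseteq> realization_points L"
    proof
      fix x assume "x \<in> realization_points M \<inter> (\<Union>\<tau>\<in>L. {x. support x \<subseteq> \<tau>})"
      then obtain \<tau> where "x \<in> points" "\<tau> \<in> L" "support x \<subseteq> \<tau>"
        using assms(2) by (auto simp: points_subcomplex)
      then show "x \<in> realization_points L"
        using subcomplexD(2)[OF assms(1)] pointD(5) assms(1) by (simp add: points_subcomplex)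
    qed
  qed
  moreover have "closed (\<Union>\<tau>\<in>L. {x :: 'v \<Rightarrow> real. support x \<subseteq> \<tau>})"
    using finite_subset[OF subcomplexD(1)[OF assms(1)] finite_K]
    by (intro closed_UN) (auto intro: closed_support_subset)
  ultimately show ?thesis by (metis closedin_closed_Int)
qed

lemma quotient_map_proj: "quotient_map (top_of_set points) orbits_space proj"
  using quotient_map_quotient_topology[of "geometric_realization K" proj]
  by (simp add: orbit_space_def geometric_realization_def)

lemma topspace_orbits_space: "topspace orbits_space = proj ` points"
  using quotient_imp_surjective_map[OF quotient_map_proj] by simp

text \<open>
  The points of a subcomplex form a closed set that is a union of orbits.
\<close>

lemma quotient_map_proj_subcomplex:
  assumes L: "subcomplex L"
  shows "quotient_map (top_of_set (realization_points L))
    (subtopology orbits_space (proj ` realization_points L)) proj"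
proof -
  have LX: "realization_points L \<subseteq> points" using L by (auto simp: points_subcomplex)
  have sat: "{x \<in> topspace (top_of_set points). proj x \<in> proj ` realization_points L}
      = realization_points L"
  proof
    show "{x \<in> topspace (top_of_set points). proj x \<in> proj ` realization_points L}
      \<subseteq> realization_points L"
    proof
      fix x assume "x \<in> {x \<in> topspace (top_of_set points). proj x \<in> proj ` realization_points L}"
      then obtain y where x: "x \<in> points" and y: "y \<in> realization_points L" "proj y = proj x" by auto
      then obtain g where "g \<in> carrier G" "x = act g y" using proj_eqD LX by blast
      then show "x \<in> realization_points L" using act_points_subcomplex[OF L y(1)] by simp
    qed
  qed (use LX in auto)
  have sub: "proj ` realization_points L \<subseteq> topspace orbits_space"
    using LX quotient_imp_surjective_map[OF quotient_map_proj] by auto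
  have "closedin orbits_space (proj ` realization_points L)"
    using quotient_map_proj[unfolded quotient_map_closedin, THEN conjunct2, rule_format, OF sub]
      closedin_points_subcomplex[OF L subcomplex_K subcomplexD(1)[OF L]]
    unfolding sat by blast
  then have "quotient_map (subtopology (top_of_set points) (realization_points L))
      (subtopology orbits_space (proj ` realization_points L)) proj"
    using quotient_map_restriction[OF quotient_map_proj sat] by blast
  then show ?thesis using LX by (simp add: subtopology_subtopology inf_absorb2)
qed

section \<open>Collapsing a free orbit\<close>

lemma push_points:
  assumes "insert r \<sigma> \<in> K" "r \<notin> \<sigma>" "x \<in> points" "support x \<subseteq> insert r \<sigma>" "0 \<le> t" "t \<le> 1"
  shows "push \<sigma> r t x \<in> points"
proof (rule pointI[OF _ assms(1)])
  have fin: "finite \<sigma>" using finite_simplex[OF assms(1)] by simp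
  show "0 \<le> push \<sigma> r t x v" for v
    by (rule push_nonneg[OF fin pointD(1)[OF assms(3)] assms(5,6)])
  show "support (push \<sigma> r t x) \<subseteq> insert r \<sigma>" by (rule support_push[OF assms(4)])
  have "sum x (insert r \<sigma>) = 1"
    using support_restrict_eq[OF assms(4)] fin pointD(4)[OF assms(3)] by simp
  then show "sum (push \<sigma> r t x) (insert r \<sigma>) = 1" using sum_push[OF fin assms(2)] by simp
qed

text \<open>
  Only the orbits of \<open>\<sigma>\<close> and \<open>insert r \<sigma>\<close> are removed; as \<open>L\<close> is closed under faces, this forces
  \<open>\<sigma>\<close> to be a free face up to the action. On the translate of the simplex by \<open>g\<close>, the homotopy pulls
  a point back by \<open>g\<close>, pushes it, and takes the orbit. Different translates give the same value since
  a closed simplex meets an orbit at most once, so the pieces can be pasted.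
\<close>

lemma orbit_collapse:
  assumes L: "subcomplex L" and M: "subcomplex M" and LM: "L \<subseteq> M"
    and \<sigma>: "\<sigma> \<noteq> {}" "r \<notin> \<sigma>" "insert r \<sigma> \<in> M" "\<sigma> \<notin> L"
    and cover: "\<And>\<rho>. \<rho> \<in> M \<Longrightarrow> \<rho> \<in> L \<or> (\<exists>g\<in>carrier G. \<rho> = \<phi> g ` \<sigma> \<or> \<rho> = \<phi> g ` insert r \<sigma>)"
  shows "subtopology orbits_space (proj ` realization_points M) homotopy_equivalent_space
         subtopology orbits_space (proj ` realization_points L)"
proof -
  let ?XL = "realization_points L" and ?XM = "realization_points M" and ?I = "{0..1::real}"
  let ?YL = "subtopology orbits_space (proj ` realization_points L)"
  let ?YM = "subtopology orbits_space (proj ` realization_points M)"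
  let ?\<tau> = "insert r \<sigma>"
  (* F g is the translate of the closed simplex by g, and h g the push on it, moved to the original simplex *)
  define F where "F g = {x \<in> ?XM. support x \<subseteq> \<phi> g ` ?\<tau>}" for g
  define h where "h g t x = push \<sigma> r t (act (inv g) x)" for g t x
  have tauK: "?\<tau> \<in> K" using \<sigma>(3) subcomplexD(1)[OF M] by blast
  have fin: "finite \<sigma>" using finite_simplex[OF tauK] by simp
  have XM: "?XM = {x \<in> points. support x \<in> M}" and XL: "?XL = {x \<in> points. support x \<in> L}"
    using points_subcomplex[OF M] points_subcomplex[OF L] by auto
  have LX: "?XL \<subseteq> ?XM" using LM by (auto simp: XM XL)
  have tauV: "?\<tau> \<subseteq> \<Union>K" using tauK by blast
  have pull: "act (inv g) x \<in> points" "support (act (inv g) x) \<subseteq> ?\<tau>"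
    if g: "g \<in> carrier G" and x: "x \<in> F g" for g x
  proof -
    have x': "x \<in> points" "support x \<subseteq> \<phi> g ` ?\<tau>" using x by (auto simp: F_def XM)
    show "act (inv g) x \<in> points" using act_points x' g by simp
    have "support (act (inv g) x) \<subseteq> \<phi> (inv g) ` \<phi> g ` ?\<tau>"
      unfolding support_act[OF x'(1) inv_closed[OF g]] using x'(2) by (rule image_mono)
    then show "support (act (inv g) x) \<subseteq> ?\<tau>" using image_inv(1)[OF g tauV] by simp
  qed
  have h_points: "h g t x \<in> points" "support (h g t x) \<subseteq> ?\<tau>" "h g t x \<in> ?XM"
    if "g \<in> carrier G" "x \<in> F g" "t \<in> ?I" for g t x
  proof -
    note b = pull[OF that(1,2)]
    show 1: "h g t x \<in> points"
      unfolding h_def using push_points[OF tauK \<sigma>(2) b] that(3) by simp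
    show 2: "support (h g t x) \<subseteq> ?\<tau>"
      unfolding h_def by (rule support_push[OF b(2)])
    show "h g t x \<in> ?XM"
      using 1 subcomplexD(2)[OF M \<sigma>(3) 2 pointD(5)[OF 1]] by (simp add: XM)
  qed
  have h_L: "h g t x = act (inv g) x" if g: "g \<in> carrier G" and x: "x \<in> F g" "x \<in> ?XL" for g t x
  proof -
    have "x \<in> points" "support x \<in> L" using x by (auto simp: XL)
    then have s: "support (act (inv g) x) \<in> L"
      using support_act[of x "inv g"] subcomplexD(3)[OF L] g by simp
    have "\<not> \<sigma> \<subseteq> support (act (inv g) x)"
      using subcomplexD(2)[OF L s] \<sigma>(1,4) by blast
    then show ?thesis
      unfolding h_def by (rule push_stationary[OF fin pointD(1)[OF pull(1)[OF g x(1)]]])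
  qed
  have h_1: "h g 1 x \<in> ?XL" if g: "g \<in> carrier G" and x: "x \<in> F g" for g x
  proof -
    let ?s = "support (h g 1 x)"
    have p: "h g 1 x \<in> points" "?s \<subseteq> ?\<tau>" "h g 1 x \<in> ?XM" using h_points[OF g x] by auto
    have n: "\<not> \<sigma> \<subseteq> ?s" unfolding h_def by (rule push_1_not_full[OF fin \<sigma>(1)])
    have "?s \<in> M" using p(3) by (simp add: XM)
    have "?s \<in> L"
    proof (rule ccontr)
      assume "?s \<notin> L"
      then obtain k where k: "k \<in> carrier G" "?s = \<phi> k ` \<sigma> \<or> ?s = \<phi> k ` ?\<tau>"
        using cover[OF \<open>?s \<in> M\<close>] by blast
      then have "\<phi> k ` \<sigma> \<subseteq> ?s" by blast
      moreover have "\<phi> k ` \<sigma> = \<sigma>"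
        by (rule image_simplex_eq[OF k(1) tauK]) (use calculation p(2) in auto)
      ultimately show False using n by simp
    qed
    then show ?thesis using p(1) by (simp add: XL)
  qed
  have h_0: "proj (h g 0 x) = proj x" if g: "g \<in> carrier G" and x: "x \<in> F g" for g x
  proof -
    have "x \<in> points" using x by (auto simp: F_def XM)
    then show ?thesis unfolding h_def push_0 using proj_act g by simp
  qed
  (* with l equal to the unit this is agreement on overlaps, for general l it is invariance *)
  have h_unique: "h g t x = h k t y"
    if g: "g \<in> carrier G" and k: "k \<in> carrier G" and l: "l \<in> carrier G"
      and x: "x \<in> F g" and y: "y \<in> F k" "y = act l x" for g k l t x y
  proof -
    have xp: "x \<in> points" using x by (auto simp: F_def XM)
    have "act (inv k \<otimes> (l \<otimes> g)) (act (inv g) x) = act (inv k) y"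
      using xp g k l by (simp add: act_mult act_inv y(2))
    moreover have "act (inv k \<otimes> (l \<otimes> g)) (act (inv g) x) = act (inv g) x"
      by (rule act_eq_self[OF pull(1)[OF g x] _ tauK pull(2)[OF g x]])
        (use calculation pull[OF k y(1)] g k l in auto)
    ultimately show ?thesis by (simp add: h_def)
  qed
  have XM_cover: "x \<in> ?XL \<or> (\<exists>g\<in>carrier G. x \<in> F g)" if "x \<in> ?XM" for x
  proof -
    have x: "x \<in> points" "support x \<in> M" using that by (auto simp: XM)
    show ?thesis
    proof (cases "support x \<in> L")
      case True then show ?thesis using x by (simp add: XL)
    next
      case False
      then obtain g where "g \<in> carrier G" "support x \<subseteq> \<phi> g ` ?\<tau>" using cover[OF x(2)] by blast
      then show ?thesis using that by (auto simp: F_def)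
    qed
  qed

  let ?D = "top_of_set (?I \<times> ?XM)"
  have qM: "quotient_map (top_of_set ?XM) ?YM proj" and qL: "quotient_map (top_of_set ?XL) ?YL proj"
    using quotient_map_proj_subcomplex M L by auto
  (* the index None stands for L, where the homotopy is constant, and Some g for the translate by g *)
  define T where "T i = (case i of None \<Rightarrow> ?I \<times> ?XL | Some g \<Rightarrow> ?I \<times> F g)" for i
  define f where "f i = (case i of None \<Rightarrow> (\<lambda>(t, x). proj x) | Some g \<Rightarrow> (\<lambda>(t, x). proj (h g t x)))" for i
  let ?J = "insert None (Some ` carrier G)"
  have closed_F: "closedin (top_of_set ?XM) (F g)" for g
  proof -
    have "F g = ?XM \<inter> {x. support x \<subseteq> \<phi> g ` ?\<tau>}" by (auto simp: F_def)
    then show ?thesis by (metis closed_support_subset closedin_closed_Int)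
  qed
  have cont: "continuous_map (top_of_set (?I \<times> S)) ?YM (\<lambda>z. proj (k z))"
    if "continuous_on (?I \<times> S) k" "k ` (?I \<times> S) \<subseteq> ?XM" for S k
    using continuous_map_compose[of "top_of_set (?I \<times> S)" "top_of_set ?XM" k ?YM proj]
      quotient_imp_continuous_map[OF qM] that by (simp add: o_def image_subset_iff_funcset)
  have "\<exists>H. continuous_map ?D ?YM H \<and> (\<forall>z i. i \<in> ?J \<longrightarrow> z \<in> topspace ?D \<inter> T i \<longrightarrow> H z = f i z)"
  proof (rule pasting_lemma_exists_closed[of ?J ?D T ?YM f])
    show "finite ?J" using finite_carrier by simp
    show "topspace ?D \<subseteq> \<Union> (T ` ?J)"
    proof
      fix z assume "z \<in> topspace ?D"
      then obtain t x where z: "z = (t, x)" "t \<in> ?I" "x \<in> ?XM" by auto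
      then have "z \<in> T None \<or> (\<exists>g\<in>carrier G. z \<in> T (Some g))"
        using XM_cover[OF z(3)] by (auto simp: T_def)
      then show "z \<in> \<Union> (T ` ?J)" by blast
    qed
    show "closedin ?D (T i)" if "i \<in> ?J" for i
    proof (cases i)
      case None
      then show ?thesis
        using closedin_Times[OF _ closedin_points_subcomplex[OF L M LM], of ?I ?I] by (simp add: T_def)
    next
      case (Some g)
      then show ?thesis using closedin_Times[OF _ closed_F, of ?I ?I g] by (simp add: T_def)
    qed
    show "continuous_map (subtopology ?D (T i)) ?YM (f i)" if i: "i \<in> ?J" for i
    proof (cases i)
      case None
      have "(?I \<times> ?XM) \<inter> (?I \<times> ?XL) = ?I \<times> ?XL" using LX by blast
      moreover have "continuous_map (top_of_set (?I \<times> ?XL)) ?YM (\<lambda>z. proj (snd z))"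
        by (rule cont) (use LX in \<open>auto intro: continuous_intros\<close>)
      ultimately show ?thesis
        using None by (simp add: T_def f_def subtopology_subtopology case_prod_unfold)
    next
      case (Some g)
      then have g: "g \<in> carrier G" using i by auto
      have "(?I \<times> ?XM) \<inter> (?I \<times> F g) = ?I \<times> F g" by (auto simp: F_def)
      moreover have "continuous_map (top_of_set (?I \<times> F g)) ?YM (\<lambda>z. proj (h g (fst z) (snd z)))"
      proof (rule cont)
        show "continuous_on (?I \<times> F g) (\<lambda>z. h g (fst z) (snd z))"
          unfolding h_def
          by (intro continuous_on_push[OF fin \<sigma>(1)] continuous_on_compose2[OF continuous_on_act]
              continuous_intros) auto
        show "(\<lambda>z. h g (fst z) (snd z)) ` (?I \<times> F g) \<subseteq> ?XM"
          using h_points(3)[OF g] by auto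
      qed
      ultimately show ?thesis
        using Some by (simp add: T_def f_def subtopology_subtopology case_prod_unfold)
    qed
    show "f i z = f j z" if i: "i \<in> ?J" and j: "j \<in> ?J" and z: "z \<in> topspace ?D \<inter> T i \<inter> T j" for i j z
    proof -
      obtain t x where tx: "z = (t, x)" by (cases z)
      have F_F: "proj (h g t x) = proj (h k t x)"
        if "g \<in> carrier G" "k \<in> carrier G" "x \<in> F g" "x \<in> F k" for g k
      proof -
        have "act \<one> x = x" by (rule act_one) (use that(3) in \<open>auto simp: F_def XM\<close>)
        then have "h g t x = h k t x" using h_unique[OF that(1,2) one_closed that(3,4)] by simp
        then show ?thesis by simp
      qed
      have L_F: "proj (h g t x) = proj x" if "g \<in> carrier G" "x \<in> F g" "x \<in> ?XL" for g
        unfolding h_L[OF that] using proj_act[of x "inv g"] that by (simp add: XL)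
      consider "i = None" "j = None" | g where "i = None" "j = Some g" | g where "i = Some g" "j = None"
        | g k where "i = Some g" "j = Some k"
        by (cases i; cases j) auto
      then show ?thesis
      proof cases
        case 1 then show ?thesis by simp
      next
        case (2 g)
        then have "g \<in> carrier G" "x \<in> F g" "x \<in> ?XL" using j z by (auto simp: tx T_def)
        then show ?thesis using 2 L_F by (simp add: f_def tx)
      next
        case (3 g)
        then have "g \<in> carrier G" "x \<in> F g" "x \<in> ?XL" using i z by (auto simp: tx T_def)
        then show ?thesis using 3 L_F by (simp add: f_def tx)
      next
        case (4 g k)
        then have "g \<in> carrier G" "k \<in> carrier G" "x \<in> F g" "x \<in> F k"
          using i j z by (auto simp: tx T_def)
        from F_F[OF this] show ?thesis unfolding 4 f_def tx by simp
      qed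
    qed
    show "\<exists>H. continuous_map ?D ?YM H \<and> (\<forall>z i. i \<in> ?J \<longrightarrow> z \<in> topspace ?D \<inter> T i \<longrightarrow> H z = f i z)"
      if "continuous_map ?D ?YM H" "\<And>z i. \<lbrakk>i \<in> ?J; z \<in> topspace ?D \<inter> T i\<rbrakk> \<Longrightarrow> H z = f i z" for H
      using that by blast
  qed
  then obtain H where H: "continuous_map ?D ?YM H"
    and Hf: "\<And>z i. \<lbrakk>i \<in> ?J; z \<in> topspace ?D \<inter> T i\<rbrakk> \<Longrightarrow> H z = f i z"
    by blast
  have H_L: "H (t, x) = proj x" if "t \<in> ?I" "x \<in> ?XL" for t x
    using Hf[of None "(t, x)"] that LX by (auto simp: T_def f_def)
  have H_F: "H (t, x) = proj (h g t x)" if "t \<in> ?I" "g \<in> carrier G" "x \<in> F g" for t x g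
    using Hf[of "Some g" "(t, x)"] that by (auto simp: T_def f_def F_def)
  have H_0: "H (0, x) = proj x" if "x \<in> ?XM" for x
    using XM_cover[OF that] H_L[of 0 x] H_F[of 0 _ x] h_0 by auto
  have H_1: "H (1, x) \<in> proj ` ?XL" if "x \<in> ?XM" for x
    using XM_cover[OF that] H_L[of 1 x] H_F[of 1 _ x] h_1 by auto
  have H_invariant: "H (t, x) = H (t, y)"
    if t: "t \<in> ?I" and x: "x \<in> ?XM" and y: "y \<in> ?XM" and eq: "proj x = proj y" for t x y
  proof -
    obtain l where l: "l \<in> carrier G" "y = act l x"
      using proj_eqD[of x y] x y eq by (auto simp: XM)
    show ?thesis
    proof (cases "x \<in> ?XL")
      case True
      then have "y \<in> ?XL" using act_points_subcomplex[OF L] l by simp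
      then show ?thesis using H_L[OF t] True eq by simp
    next
      case False
      then obtain g where g: "g \<in> carrier G" "x \<in> F g" using XM_cover[OF x] by blast
      have "support y = \<phi> l ` support x" unfolding l(2) by (rule support_act) (use x l in \<open>auto simp: XM\<close>)
      also have "\<dots> \<subseteq> \<phi> l ` \<phi> g ` ?\<tau>" using g(2) by (auto simp: F_def)
      also have "\<dots> = \<phi> (l \<otimes> g) ` ?\<tau>" by (rule image_mult[OF l(1) g(1) tauV])
      finally have yF: "y \<in> F (l \<otimes> g)" using y by (simp add: F_def)
      have lg: "l \<otimes> g \<in> carrier G" using l g by simp
      show ?thesis
        using h_unique[OF g(1) lg l(1) g(2) yF l(2)] H_F[OF t g] H_F[OF t lg yF] by simp
    qed
  qed

  have q2: "quotient_map (prod_topology (top_of_set ?I) (top_of_set ?XM))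
      (prod_topology (top_of_set ?I) ?YM) (\<lambda>(t, x). (t, proj x))"
    by (rule quotient_map_prod_right[OF _ _ qM])
      (simp_all add: compact_imp_locally_compact_space compact_space_subtopology Hausdorff_space_subtopology)
  have D: "prod_topology (top_of_set ?I) (top_of_set ?XM) = ?D" by simp
  have H_eq: "H z = H w" if z: "z \<in> topspace ?D" and w: "w \<in> topspace ?D"
    and eq: "(\<lambda>(t, x). (t, proj x)) z = (\<lambda>(t, x). (t, proj x)) w" for z w
  proof -
    obtain t x u y where zw: "z = (t, x)" "w = (u, y)" by (cases z, cases w) auto
    then have "t \<in> ?I" "x \<in> ?XM" "y \<in> ?XM" "proj x = proj y" "t = u" using z w eq by auto
    then show ?thesis using H_invariant zw by blast
  qed
  have "\<exists>R. continuous_map (prod_topology (top_of_set ?I) ?YM) ?YM R \<and>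
      (\<forall>z \<in> topspace ?D. R ((\<lambda>(t, x). (t, proj x)) z) = H z)"
    by (rule quotient_map_lift_exists[OF q2[unfolded D] H], rule H_eq, assumption+, blast)
  then obtain R where R: "continuous_map (prod_topology (top_of_set ?I) ?YM) ?YM R"
    and RH: "\<And>z. z \<in> topspace ?D \<Longrightarrow> R ((\<lambda>(t, x). (t, proj x)) z) = H z"
    by blast
  have R': "R (t, proj x) = H (t, x)" if "t \<in> ?I" "x \<in> ?XM" for t x
    using RH[of "(t, x)"] that by simp
  have topYM: "topspace ?YM = proj ` ?XM" and topYL: "topspace ?YL = proj ` ?XL"
    using quotient_imp_surjective_map[OF qM] quotient_imp_surjective_map[OF qL] by auto
  have YL: "?YL = subtopology ?YM (proj ` ?XL)"
    using LX by (simp add: subtopology_subtopology inf_absorb2 image_mono)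
  have "continuous_map ?YM ?YM (\<lambda>y. R (1, y))"
    using continuous_map_compose[OF _ R, of ?YM "\<lambda>y. (1, y)"]
    by (simp add: o_def continuous_map_pairedI)
  then have r: "continuous_map ?YM ?YL (\<lambda>y. R (1, y))"
    unfolding YL by (rule continuous_map_into_subtopology) (auto simp: topYM R' H_1)
  have "homotopic_with (\<lambda>_. True) ?YM ?YM id (\<lambda>y. R (1, y))"
    by (subst homotopic_with, simp, rule exI[of _ R]) (use R in \<open>auto simp: topYM R' H_0\<close>)
  then have "homotopic_with (\<lambda>_. True) ?YM ?YM (\<lambda>y. R (1, y)) id"
    by (rule homotopic_with_symD)
  moreover have "retraction_maps ?YM ?YL (\<lambda>y. R (1, y)) id"
    unfolding retraction_maps_def
  proof (intro conjI ballI)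
    show "continuous_map ?YL ?YM id"
      unfolding YL by (simp add: continuous_map_from_subtopology)
    show "R (1, id y) = y" if y: "y \<in> topspace ?YL" for y
    proof -
      obtain x where x: "x \<in> ?XL" "y = proj x" using y unfolding topYL by blast
      then have "x \<in> ?XM" using LX by blast
      then show ?thesis using R'[of 1 x] H_L[of 1 x] x by simp
    qed
  qed (rule r)
  ultimately show ?thesis by (rule deformation_retract_imp_homotopy_equivalent_space)
qed

end

section \<open>Acyclic matchings on orbits\<close>

text \<open>
  An acyclic matching on the orbits of simplices, with one unmatched orbit of vertices. It is
  written as an equivariant relation between a simplex and the vertex to be added, because this vertex is
  determined only up to the stabilizer of the simplex. Acyclicity is witnessed by \<open>\<mu>\<close>: it
  increases whenever one passes from a lower simplex to another facet of its partner.
\<close>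

locale orbit_matching = regular_complex G K \<phi>
  for G :: "('g, 'm) monoid_scheme" (structure) and K :: "'v set set" and \<phi> +
  fixes M :: "'v set \<Rightarrow> 'v \<Rightarrow> bool" and \<mu> :: "'v set \<Rightarrow> nat" and v\<^sub>0 :: 'v
  assumes match_simplex: "M \<sigma> r \<Longrightarrow> \<sigma> \<in> K \<and> r \<notin> \<sigma> \<and> insert r \<sigma> \<in> K"
    and match_equivariant: "\<lbrakk>M \<sigma> r; g \<in> carrier G\<rbrakk> \<Longrightarrow> M (\<phi> g ` \<sigma>) (\<phi> g r)"
    and match_up: "\<lbrakk>M \<sigma> r; M \<sigma> r'\<rbrakk> \<Longrightarrow> \<exists>g\<in>carrier G. \<phi> g ` \<sigma> = \<sigma> \<and> \<phi> g r = r'"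
    and match_down: "\<lbrakk>M \<sigma> r; M \<sigma>' r'; insert r \<sigma> = insert r' \<sigma>'\<rbrakk> \<Longrightarrow> \<sigma> = \<sigma>'"
    and match_disjoint: "M \<sigma> r \<Longrightarrow> \<not> M (insert r \<sigma>) r'"
    and match_cover: "\<rho> \<in> K \<Longrightarrow>
      (\<exists>r. M \<rho> r) \<or> (\<exists>\<sigma> r. M \<sigma> r \<and> \<rho> = insert r \<sigma>) \<or> (\<exists>g\<in>carrier G. \<rho> = {\<phi> g v\<^sub>0})"
    and critical: "{v\<^sub>0} \<in> K" "\<not> M {v\<^sub>0} r"
    and match_acyclic: "\<lbrakk>M \<sigma> r; v \<in> \<sigma>\<rbrakk> \<Longrightarrow> \<mu> \<sigma> < \<mu> (insert r \<sigma> - {v})"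
begin

text \<open>
  The orbits of the vertex \<open>v\<^sub>0\<close> give a single point of the orbit space.
\<close>

lemma proj_vertex:
  assumes x: "x \<in> points" "support x = {\<phi> g v\<^sub>0}"
    and y: "y \<in> points" "support y = {\<phi> h v\<^sub>0}" and g: "g \<in> carrier G" "h \<in> carrier G"
  shows "proj x = proj y"
proof -
  have v: "v\<^sub>0 \<in> \<Union>K" using critical(1) by blast
  let ?k = "h \<otimes> inv g"
  have "\<phi> ?k (\<phi> g v\<^sub>0) = \<phi> h (\<phi> (inv g) (\<phi> g v\<^sub>0))"
    using vertex_mult[of h "inv g" "\<phi> g v\<^sub>0"] g vertex_closed[OF g(1) v] by simp
  also have "\<dots> = \<phi> h v\<^sub>0" using vertex_inv(1)[OF g(1) v] by simp
  finally have s: "support (act ?k x) = {\<phi> h v\<^sub>0}"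
    using support_act[OF x(1), of ?k] x(2) g by simp
  have p: "act ?k x \<in> points" using act_points[OF x(1)] g by simp
  have "z = (\<lambda>v. if v = \<phi> h v\<^sub>0 then 1 else 0)" if z: "z \<in> points" "support z = {\<phi> h v\<^sub>0}" for z
  proof
    fix v
    have "z (\<phi> h v\<^sub>0) = 1" using pointD(4)[OF z(1)] unfolding z(2) by simp
    then show "z v = (if v = \<phi> h v\<^sub>0 then 1 else 0)" using z(2) by (cases "v = \<phi> h v\<^sub>0") auto
  qed
  from this[OF p s] this[OF y] have "act ?k x = y" by simp
  then show ?thesis using proj_act[OF x(1), of ?k] g by simp
qed

text \<open>
  Among the lower simplices of greatest dimension, one with the least value of \<open>\<mu>\<close> has only its
  partners as proper cofaces: any further coface would be the partner of a lower simplex of the same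
  dimension and smaller \<open>\<mu>\<close>. Its pair can be collapsed, and the rest is again a matched subcomplex.
\<close>

lemma contractible_matched_subcomplex:
  assumes "subcomplex L" "{v\<^sub>0} \<in> L" "\<And>\<sigma> r. \<lbrakk>\<sigma> \<in> L; M \<sigma> r\<rbrakk> \<Longrightarrow> insert r \<sigma> \<in> L"
  shows "contractible_space (subtopology orbits_space (proj ` realization_points L))"
  using assms
proof (induction "card L" arbitrary: L rule: less_induct)
  case less
  note L = \<open>subcomplex L\<close>
  have LK: "L \<subseteq> K" by (rule subcomplexD(1)[OF L])
  have finL: "finite L" by (rule finite_subset[OF LK finite_K])
  have cardL: "card (\<phi> g ` \<sigma>) = card \<sigma>" if "g \<in> carrier G" "\<sigma> \<in> L" for g \<sigma>
    using card_image_simplex that LK by blast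
  have ne: "\<sigma> \<noteq> {}" if "\<sigma> \<in> L" for \<sigma> using that LK empty_notin_K by blast
  define D where "D = {\<sigma> \<in> L. \<exists>r. M \<sigma> r}"
  have lower_in_D: "\<sigma> \<in> D" if "M \<sigma> r" "insert r \<sigma> \<in> L" for \<sigma> r
    using subcomplexD(2)[OF L that(2), of \<sigma>] match_simplex[OF that(1)] empty_notin_K that(1)
    by (auto simp: D_def)
  show ?case
  proof (cases "D = {}")
    case True
    have "proj ` realization_points L \<subseteq> {proj x}" if x: "x \<in> realization_points L" for x
    proof -
      have "\<exists>g\<in>carrier G. support y = {\<phi> g v\<^sub>0}" if "y \<in> realization_points L" for y
      proof -
        have "support y \<in> L" using that by (simp add: points_subcomplex[OF L])
        moreover have "\<not> (\<exists>r. M (support y) r)" using calculation True by (auto simp: D_def)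
        moreover have "\<not> (\<exists>\<sigma> r. M \<sigma> r \<and> support y = insert r \<sigma>)"
          using calculation(1) lower_in_D True by (metis empty_iff)
        ultimately show ?thesis using match_cover[OF subsetD[OF LK], of "support y"] by metis
      qed
      note vert = this
      show ?thesis
      proof clarify
        fix y assume y: "y \<in> realization_points L"
        obtain g h where gh: "g \<in> carrier G" "support y = {\<phi> g v\<^sub>0}" "h \<in> carrier G" "support x = {\<phi> h v\<^sub>0}"
          using vert[OF x] vert[OF y] by blast
        have "y \<in> points" "x \<in> points" using x y by (auto simp: points_subcomplex[OF L])
        then show "proj y = proj x" using proj_vertex gh by blast
      qed
    qed
    then have "\<exists>c. proj ` realization_points L \<subseteq> {c}" by blast
    then obtain c where "proj ` realization_points L \<subseteq> {c}" by blast
    then have "topspace (subtopology orbits_space (proj ` realization_points L)) \<subseteq> {c}" by auto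
    then show ?thesis by (rule contractible_space_subset_singleton)
  next
    case False
    have finD: "finite D" using finL by (simp add: D_def)
    (* the greatest dimension first, so that no coface of the chosen simplex is a lower one *)
    define d where "d = Max (card ` D)"
    have d: "card \<sigma> \<le> d" if "\<sigma> \<in> D" for \<sigma> using that finD by (simp add: d_def)
    have "d \<in> card ` D" unfolding d_def using finD False by (intro Max_in) auto
    then obtain \<sigma>' where "\<sigma>' \<in> D \<and> card \<sigma>' = d" by auto
    then obtain \<sigma> where \<sigma>: "\<sigma> \<in> D" "card \<sigma> = d"
      and min: "\<And>\<rho>. \<lbrakk>\<rho> \<in> D; card \<rho> = d\<rbrakk> \<Longrightarrow> \<mu> \<sigma> \<le> \<mu> \<rho>"
      using ex_has_least_nat[of "\<lambda>\<sigma>. \<sigma> \<in> D \<and> card \<sigma> = d" \<sigma>' \<mu>] by blast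
    then obtain r where r: "M \<sigma> r" and sL: "\<sigma> \<in> L" by (auto simp: D_def)
    have rs: "r \<notin> \<sigma>" using match_simplex[OF r] by simp
    have tL: "insert r \<sigma> \<in> L" using less.prems(3)[OF sL r] .
    have finS: "finite \<rho>" if "\<rho> \<in> L" for \<rho> using finite_simplex that LK by blast
    have sV: "\<sigma> \<subseteq> \<Union>K" and tV: "insert r \<sigma> \<subseteq> \<Union>K" using sL tL LK by blast+
    have free: "\<exists>g\<in>carrier G. \<rho> = \<phi> g ` insert r \<sigma>" if \<rho>: "\<rho> \<in> L" "\<sigma> \<subset> \<rho>" for \<rho>
    proof -
      have c: "d < card \<rho>" using psubset_card_mono[OF finS[OF \<rho>(1)] \<rho>(2)] \<sigma>(2) by simp
      have "\<rho> \<notin> D" using d c by fastforce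
      moreover have "\<rho> \<noteq> {\<phi> g v\<^sub>0}" for g using \<rho>(2) ne[OF sL] by auto
      ultimately obtain \<sigma>' r' where m: "M \<sigma>' r'" "\<rho> = insert r' \<sigma>'"
        using match_cover[OF subsetD[OF LK \<rho>(1)]] \<rho>(1) unfolding D_def by blast
      have D': "\<sigma>' \<in> D" using lower_in_D[OF m(1)] m(2) \<rho>(1) by simp
      then have "finite \<sigma>'" using finS by (auto simp: D_def)
      moreover have r': "r' \<notin> \<sigma>'" using match_simplex[OF m(1)] by simp
      ultimately have c': "card \<rho> = Suc (card \<sigma>')" using m(2) by simp
      then have cd: "card \<sigma>' = d" using c d[OF D'] by simp
      have "\<sigma>' = \<sigma>"
      proof (rule ccontr)
        assume n: "\<sigma>' \<noteq> \<sigma>"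
        have "card (\<rho> - \<sigma>) = 1"
          using c' cd \<sigma>(2) \<rho>(2) finS[OF sL] by (simp add: card_Diff_subset)
        then obtain v where v: "\<rho> - \<sigma> = {v}" by (rule card_1_singletonE)
        then have sv: "\<sigma> = \<rho> - {v}" "v \<in> \<rho>" using \<rho>(2) by blast+
        have "v \<noteq> r'" using n sv m(2) r' by auto
        then have "v \<in> \<sigma>'" using sv m(2) by simp
        then have "\<mu> \<sigma>' < \<mu> \<sigma>" using match_acyclic[OF m(1)] sv m(2) by simp
        then show False using min[OF D' cd] by simp
      qed
      then obtain g where g: "g \<in> carrier G" "\<phi> g ` \<sigma> = \<sigma>" "\<phi> g r = r'"
        using match_up[OF r] m(1) by blast
      then have "\<phi> g ` insert r \<sigma> = \<rho>" using m(2) \<open>\<sigma>' = \<sigma>\<close> by simp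
      then show ?thesis using g(1) by blast
    qed
    define R where "R = {\<phi> g ` \<sigma> | g. g \<in> carrier G} \<union> {\<phi> g ` insert r \<sigma> | g. g \<in> carrier G}"
    have R: "\<rho> \<in> R \<longleftrightarrow> (\<exists>g\<in>carrier G. \<rho> = \<phi> g ` \<sigma> \<or> \<rho> = \<phi> g ` insert r \<sigma>)" for \<rho>
      by (auto simp: R_def)
    have sR: "\<sigma> \<in> R"
      unfolding R by (rule bexI[of _ \<one>]) (simp_all add: image_one[OF sV])
    have R_image: "\<phi> k ` \<rho> \<in> R" if \<rho>: "\<rho> \<in> R" and k: "k \<in> carrier G" for \<rho> k
    proof -
      obtain g where g: "g \<in> carrier G" "\<rho> = \<phi> g ` \<sigma> \<or> \<rho> = \<phi> g ` insert r \<sigma>"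
        using \<rho> unfolding R by blast
      then have "\<phi> k ` \<rho> = \<phi> (k \<otimes> g) ` \<sigma> \<or> \<phi> k ` \<rho> = \<phi> (k \<otimes> g) ` insert r \<sigma>"
        using image_mult[OF k g(1) sV] image_mult[OF k g(1) tV] by metis
      moreover have "k \<otimes> g \<in> carrier G" using k g(1) by simp
      ultimately show ?thesis unfolding R by blast
    qed
    have R_up: "\<rho> \<in> R" if \<rho>: "\<rho> \<in> L" "\<rho>' \<in> R" "\<rho>' \<subseteq> \<rho>" for \<rho> \<rho>'
    proof -
      obtain g where g: "g \<in> carrier G" "\<phi> g ` \<sigma> \<subseteq> \<rho>"
        using \<rho>(2,3) unfolding R by blast
      let ?\<rho> = "\<phi> (inv g) ` \<rho>"
      have "\<rho> \<subseteq> \<Union>K" using \<rho>(1) LK by blast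
      then have eq: "\<phi> g ` ?\<rho> = \<rho>" using image_inv(2)[OF g(1)] by simp
      have "\<sigma> = \<phi> (inv g) ` \<phi> g ` \<sigma>" using image_inv(1)[OF g(1) sV] by simp
      also have "\<dots> \<subseteq> ?\<rho>" using g(2) by (rule image_mono)
      finally have "\<sigma> \<subseteq> ?\<rho>" .
      moreover have "?\<rho> \<in> L" using subcomplexD(3)[OF L] g(1) \<rho>(1) by simp
      ultimately have "?\<rho> = \<sigma> \<or> (\<exists>g\<in>carrier G. ?\<rho> = \<phi> g ` insert r \<sigma>)"
        using free[of ?\<rho>] by (metis psubsetI)
      then have "?\<rho> \<in> R" using sR unfolding R by metis
      then show ?thesis using R_image[OF _ g(1)] eq by metis
    qed
    let ?L = "L - R"
    have L': "subcomplex ?L"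
      unfolding subcomplex_def
    proof (intro conjI ballI allI impI)
      show "?L \<subseteq> K" using LK by blast
      show "\<rho> \<in> ?L" if "\<tau> \<in> ?L" "\<rho> \<subseteq> \<tau>" "\<rho> \<noteq> {}" for \<tau> \<rho>
        using that(1) R_up[OF _ _ that(2)] subcomplexD(2)[OF L _ that(2,3)] by auto
      show "\<phi> g ` \<tau> \<in> ?L" if g: "g \<in> carrier G" and \<tau>: "\<tau> \<in> ?L" for g \<tau>
      proof -
        have "\<tau> \<subseteq> \<Union>K" using \<tau> LK by blast
        then have "\<phi> g ` \<tau> \<notin> R"
          using R_image[of "\<phi> g ` \<tau>" "inv g"] image_inv(1)[OF g] g \<tau> by auto
        then show ?thesis using subcomplexD(3)[OF L g] \<tau> by blast
      qed
    qed
    have lowerR: "M (\<phi> g ` \<sigma>) (\<phi> g r)" if "g \<in> carrier G" for g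
      by (rule match_equivariant[OF r that])
    have v0: "{v\<^sub>0} \<in> ?L"
    proof -
      have "{v\<^sub>0} \<noteq> \<phi> g ` \<sigma>" if "g \<in> carrier G" for g
        using lowerR[OF that] critical(2) by metis
      moreover have "{v\<^sub>0} \<noteq> \<phi> g ` insert r \<sigma>" if "g \<in> carrier G" for g
      proof
        assume v0: "{v\<^sub>0} = \<phi> g ` insert r \<sigma>"
        have "card {v\<^sub>0} = card (insert r \<sigma>)" unfolding v0 by (rule cardL[OF that tL])
        then have "card (insert r \<sigma>) = 1" by simp
        then show False using rs finS[OF sL] ne[OF sL] by simp
      qed
      ultimately show ?thesis using less.prems(2) unfolding Diff_iff R by metis
    qed
    have closed: "insert s \<rho> \<in> ?L" if \<rho>: "\<rho> \<in> ?L" and s: "M \<rho> s" for \<rho> s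
    proof -
      have "insert s \<rho> \<noteq> \<phi> g ` \<sigma>" if "g \<in> carrier G" for g
        using lowerR[OF that] match_disjoint[OF s] by metis
      moreover have "insert s \<rho> \<noteq> \<phi> g ` insert r \<sigma>" if g: "g \<in> carrier G" for g
      proof
        assume "insert s \<rho> = \<phi> g ` insert r \<sigma>"
        then have "\<rho> = \<phi> g ` \<sigma>" using match_down[OF s lowerR[OF g]] by simp
        then show False using \<rho> g unfolding Diff_iff R by metis
      qed
      ultimately show ?thesis using less.prems(3)[OF _ s] \<rho> unfolding Diff_iff R by metis
    qed
    have "card ?L < card L" using sR sL finL by (intro psubset_card_mono) auto
    then have "contractible_space (subtopology orbits_space (proj ` realization_points ?L))"
      using less.hyps L' v0 closed by blast
    moreover have "subtopology orbits_space (proj ` realization_points L) homotopy_equivalent_space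
         subtopology orbits_space (proj ` realization_points ?L)"
      by (rule orbit_collapse[OF L' L _ ne[OF sL] rs tL]) (use sR R in auto)
    ultimately show ?thesis by (simp add: homotopy_equivalent_space_contractibility)
  qed
qed

theorem contractible_orbits_space: "contractible_space orbits_space"
  using contractible_matched_subcomplex[OF subcomplex_K critical(1)] match_simplex
  by (simp add: subtopology_topspace flip: topspace_orbits_space)

end

section \<open>The orbit space of the complex of p-subgroups\<close>

text \<open>
  The vertex left over by the matching is any Sylow subgroup \<open>T\<^sub>0\<close>; the complex is regular
  because comparable conjugate subgroups have the same finite order and so are equal.
\<close>

lemma contractible_p_subgroup_orbit_space:
  assumes "finite_group_prime G p" "finite_group_prime.maximal_p_subgroup G p (carrier G) T\<^sub>0"
  shows "contractible_space (p_subgroup_orbit_space G p)"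
proof -
  interpret finite_group_prime G p by fact
  note T = assms(2)
  have T': "T\<^sub>0 \<in> p_subgroups" using T by (simp add: maximal_p_subgroup_def)
  have vertex: "P \<in> p_subgroups" if "P \<in> \<Union>p_chains" for P
    using that p_chain_subgroup(1) by blast
  have crit: "{T\<^sub>0} \<in> p_chains" by (rule order_complexI) (use T' in auto)
  interpret orbit_matching G p_chains "conjugate_subset G" chain_match "\<lambda>c. card (normal_top c)" T\<^sub>0
  proof unfold_locales
    show "finite (carrier G)" by (rule finite_carrier)
    have "p_chains \<subseteq> Pow (Pow (carrier G))" using p_chain_subgroup(3) by blast
    then show "finite p_chains" using finite_carrier by (auto intro: finite_subset)
    show "finite c" if "c \<in> p_chains" for c by (rule order_complexD(2)[OF that])
    show "{} \<notin> p_chains" using order_complexD(3) by blast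
    show "d \<in> p_chains" if c: "c \<in> p_chains" and d: "d \<subseteq> c" "d \<noteq> {}" for c d
    proof (rule order_complexI)
      show "P \<subseteq> Q \<or> Q \<subseteq> P" if "P \<in> d" "Q \<in> d" for P Q
        using order_complexD(4)[OF c] d(1) that by blast
      show "finite d" by (rule finite_subset[OF d(1) order_complexD(2)[OF c]])
    qed (use order_complexD(1)[OF c] d in auto)
    show "conj_set g ` c \<in> p_chains" if "g \<in> carrier G" "c \<in> p_chains" for g c
      using conj_chain that by blast
    show "conj_set \<one>\<^bsub>G\<^esub> P = P" if "P \<in> \<Union>p_chains" for P
      by (rule conj_set_one[OF p_subgroupD(2)[OF vertex[OF that]]])
    show "conj_set (g \<otimes>\<^bsub>G\<^esub> h) P = conj_set g (conj_set h P)"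
      if "g \<in> carrier G" "h \<in> carrier G" "P \<in> \<Union>p_chains" for g h P
      by (rule conj_set_mult[OF that(1,2) p_subgroupD(2)[OF vertex[OF that(3)]]])
    show "conj_set g P = P"
      if g: "g \<in> carrier G" and c: "c \<in> p_chains" and P: "P \<in> c" "conj_set g P \<in> c" for g c P
    proof -
      have "card (conj_set g P) = card P" by (rule card_conj_set[OF g p_chain_subgroup(3)[OF c P(1)]])
      moreover have "finite P" "finite (conj_set g P)"
        using p_subgroupD(3) p_chain_subgroup(1)[OF c] P by blast+
      ultimately show ?thesis
        using order_complexD(4)[OF c P] card_subset_eq[of P "conj_set g P"]
          card_subset_eq[of "conj_set g P" P] by auto
    qed
    show "c \<in> p_chains \<and> R \<notin> c \<and> insert R c \<in> p_chains" if "chain_match c R" for c R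
      using chain_matchD[OF that] insert_between(1) by blast
    show "chain_match (conj_set g ` c) (conj_set g R)" if "chain_match c R" "g \<in> carrier G" for c R g
      using chain_match_conj that by blast
    show "\<exists>g\<in>carrier G. conj_set g ` c = c \<and> conj_set g R = R'"
      if "chain_match c R" "chain_match c R'" for c R R'
      by (rule chain_match_unique_up_to_conj[OF that])
    show "c = c'" if "chain_match c R" "chain_match c' R'" "insert R c = insert R' c'" for c c' R R'
      by (rule chain_match_lower_unique[OF that])
    show "\<not> chain_match (insert R c) R'" if "chain_match c R" for c R R'
      using chain_match_saturated[OF that] saturated_iff_unmatched_above insert_between(1)
        chain_matchD[OF that] by blast
    show "(\<exists>R. chain_match c R) \<or> (\<exists>c' R. chain_match c' R \<and> c = insert R c')
        \<or> (\<exists>g\<in>carrier G. c = {conj_set g T\<^sub>0})" if "c \<in> p_chains" for c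
      using p_chain_cases[OF that] maximal_p_subgroups_conjugate[OF subgroup_self T] by metis
    show "{T\<^sub>0} \<in> p_chains" by (rule crit)
    show "\<not> chain_match {T\<^sub>0} R" for R by (rule singleton_sylow_unmatched[OF T])
    show "card (normal_top c) < card (normal_top (insert R c - {P}))"
      if "chain_match c R" "P \<in> c" for c R P
      by (rule normal_top_grows[OF that])
  qed
  show ?thesis
    using contractible_orbits_space
    by (simp add: p_subgroup_orbit_space_def p_subgroup_complex_space_def)
qed

theorem theorem3p2:
  fixes G :: "('a, 'm) monoid_scheme" and p :: nat
  assumes "group G" and "finite (carrier G)"
    and "Factorial_Ring.prime p" and "p dvd order G"
  shows "topspace (p_subgroup_orbit_space G p) \<noteq> {}
    \<and> contractible_space (p_subgroup_orbit_space G p)"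
proof -
  interpret finite_group_prime G p
    using assms by (simp add: finite_group_prime_def finite_group_prime_axioms_def)
  obtain m where "order G = p ^ 1 * m" using assms(4) by (auto elim: dvdE)
  then obtain P where "subgroup P G" "card P = p ^ 1"
    using sylow_thm[OF assms(3,1) _ assms(2)] by blast
  then have P: "P \<in> p_subgroups" by (auto simp: nontrivial_p_subgroups_def)
  then obtain T where T: "maximal_p_subgroup (carrier G) T"
    using maximal_p_subgroup_exists[OF _ p_subgroupD(2)[OF P] subgroup_self] by blast
  let ?x = "\<lambda>Q. if Q = P then 1 else 0 :: real"
  have "{Q. ?x Q \<noteq> 0} = {P}" by auto
  moreover have "{P} \<in> p_chains" by (rule order_complexI) (use P in auto)
  ultimately have "?x \<in> realization_points p_chains"
    by (simp add: realization_points_def)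
  then have "topspace (p_subgroup_orbit_space G p) \<noteq> {}"
    by (auto simp: p_subgroup_orbit_space_def orbit_space_def topspace_quotient_topology
        p_subgroup_complex_space_def geometric_realization_def)
  then show ?thesis
    using contractible_p_subgroup_orbit_space[OF finite_group_prime_axioms T] by blast
qed

end
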